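(* Let $w$ be a nonnegative weight function on $[1,\infty)$, let $\gamma>-1$, and let $\mathcal{W}_\gamma$ be the weight function on $G=(-\infty,-1]^2\cup[1,\infty)^2$ and $P_{k,n}^{(\gamma)}$, $P_{k,n}^{(\gamma),1,1}$, $P_{k,n}^{(\gamma),1,0}$, $P_{k,n}^{(\gamma),0,1}$ the orthonormal polynomials defined in the context. For $n=0,1,2,\dots$, a mutually orthogonal basis of $\mathcal{V}_{2n}(\mathcal{W}_\gamma)$ is given by $${}_1Q_{k,2n}^{(\gamma)}(x,y):=P_{k,n}^{(\gamma)}(2xy,x^2+y^2-1),\quad 0\le k\le n,$$ $${}_2Q_{k,2n}^{(\gamma)}(x,y):=(x^2-y^2)\,P_{k,n-1}^{(\gamma),1,1}(2xy,x^2+y^2-1),\quad 0\le k\le n-1,$$ and a mutually orthogonal basis of $\mathcal{V}_{2n+1}(\mathcal{W}_\gamma)$ is given by $${}_1Q_{k,2n+1}^{(\gamma)}(x,y):=(x+y)\,P_{k,n}^{(\gamma),0,1}(2xy,x^2+y^2-1),\quad 0\le k\le n,$$ $${}_2Q_{k,2n+1}^{(\gamma)}(x,y):=(x-y)\,P_{k,n}^{(\gamma),1,0}(2xy,x^2+y^2-1),\quad 0\le k\le n.$$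
   Context: $\Pi_m^2$ is the space of real polynomials in two variables of total degree at most $m$. For a nonnegative weight $W$ on $D\subset\mathbb{R}^2$ with finite moments, $\langle f,g\rangle_W=\int_D f g\,W\,dx\,dy$, and $\mathcal{V}_m(W)$ is the space of orthogonal polynomials of degree $m$, i.e. of $P\in\Pi_m^2$ with $\langle P,q\rangle_W=0$ for all $q\in\Pi_{m-1}^2$; its dimension is $m+1$. $w$ is a nonnegative function on $[1,\infty)$ with $\int_1^\infty w>0$. Let $\triangle=\{(x,y):1<x<y<\infty\}$ and $\Omega=\{(u,v):u>2,\ u-1<v<u^2/4\}$; the map $(x,y)\mapsto(x+y,xy)$ is a bijection of $\triangle$ onto $\Omega$. For $(u,v)\in\Omega$ define $W_\gamma(u,v)=w(x)w(y)\,|u^2-4v|^\gamma$, where $(x,y)\in\triangle$ is determined by $u=x+y$, $v=xy$. It is assumed that all polynomial moments of $W_\gamma$ on $\Omega$ are finite (so that the orthogonal polynomials exist). Define on $\Omega$ $$W_\gamma^{(1,1)}(u,v)=(1-u+v)(1+u+v)W_\gamma(u,v),$$ $$W_\gamma^{(1,0)}(u,v)=(1-u+v)W_\gamma(u,v),\qquad W_\gamma^{(0,1)}(u,v)=(1+u+v)W_\gamma(u,v).$$ $\{P_{k,n}^{(\gamma)}:0\le k\le n\}$ denotes an orthonormal basis of $\mathcal{V}_n(W_\gamma)$, and $\{P_{k,n}^{(\gamma),i,j}:0\le k\le n\}$ an orthonormal basis of $\mathcal{V}_n(W_\gamma^{(i,j)})$ for $(i,j)\in\{(1,1),(1,0),(0,1)\}$.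 On $G=(-\infty,-1]^2\cup[1,\infty)^2$ define (for almost every $(x,y)$, namely when $(2xy,x^2+y^2-1)\in\Omega$) $\mathcal{W}_\gamma(x,y)=W_\gamma(2xy,x^2+y^2-1)\,|x^2-y^2|$. *)

theory Defs
  imports "HOL-Analysis.Analysis" "HOL-Library.Function_Algebras"
begin

text \<open>
  Real polynomials in two variables are identified with the functions they induce on the
  plane, regarded as vectors of the real vector space of all functions into \<open>\<real>\<close>.
\<close>

global_interpretation fun_space: vector_space "\<lambda>(c::real) (f::'a \<Rightarrow> real) x. c * f x"
  defines fun_span = fun_space.span
    and fun_dependent = fun_space.dependent
  by unfold_locales (auto simp: fun_eq_iff algebra_simps)

definition monomial :: "nat \<Rightarrow> nat \<Rightarrow> real \<times> real \<Rightarrow> real" where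
  "monomial i j = (\<lambda>(x, y). x ^ i * y ^ j)"

definition polys :: "nat \<Rightarrow> (real \<times> real \<Rightarrow> real) set" where
  "polys m = fun_span {monomial i j |i j. i + j \<le> m}"

definition finite_moments :: "(real \<times> real) set \<Rightarrow> (real \<times> real \<Rightarrow> real) \<Rightarrow> bool" where
  "finite_moments D W \<longleftrightarrow> (\<forall>i j. set_integrable lebesgue D (\<lambda>p. monomial i j p * W p))"

definition ip ::
  "(real \<times> real) set \<Rightarrow> (real \<times> real \<Rightarrow> real) \<Rightarrow>
   (real \<times> real \<Rightarrow> real) \<Rightarrow> (real \<times> real \<Rightarrow> real) \<Rightarrow> real" where
  "ip D W f g = (LINT p:D|lebesgue. f p * g p * W p)"

text \<open>The guard \<open>m \<noteq> 0\<close> accounts for the convention that the polynomials of degree at most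
  \<open>-1\<close> form the zero space.\<close>

definition orth_polys ::
  "(real \<times> real) set \<Rightarrow> (real \<times> real \<Rightarrow> real) \<Rightarrow> nat \<Rightarrow> (real \<times> real \<Rightarrow> real) set" where
  "orth_polys D W m = {P \<in> polys m. m \<noteq> 0 \<longrightarrow> (\<forall>q\<in>polys (m - 1). ip D W P q = 0)}"

definition is_basis :: "'i set \<Rightarrow> ('i \<Rightarrow> 'a \<Rightarrow> real) \<Rightarrow> ('a \<Rightarrow> real) set \<Rightarrow> bool" where
  "is_basis I f V \<longleftrightarrow> inj_on f I \<and> \<not> fun_dependent (f ` I) \<and> fun_span (f ` I) = V"

definition mutually_orthogonal_basis ::
  "(real \<times> real) set \<Rightarrow> (real \<times> real \<Rightarrow> real) \<Rightarrow> nat \<Rightarrow>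
   'i set \<Rightarrow> ('i \<Rightarrow> real \<times> real \<Rightarrow> real) \<Rightarrow> bool" where
  "mutually_orthogonal_basis D W m I f \<longleftrightarrow>
     is_basis I f (orth_polys D W m) \<and> (\<forall>i\<in>I. \<forall>j\<in>I. i \<noteq> j \<longrightarrow> ip D W (f i) (f j) = 0)"

definition orthonormal_basis ::
  "(real \<times> real) set \<Rightarrow> (real \<times> real \<Rightarrow> real) \<Rightarrow> nat \<Rightarrow>
   'i set \<Rightarrow> ('i \<Rightarrow> real \<times> real \<Rightarrow> real) \<Rightarrow> bool" where
  "orthonormal_basis D W m I f \<longleftrightarrow>
     mutually_orthogonal_basis D W m I f \<and> (\<forall>i\<in>I. ip D W (f i) (f i) = 1)"

definition Tri :: "(real \<times> real) set" where
  "Tri = {(x, y). 1 < x \<and> x < y}"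

definition Omega :: "(real \<times> real) set" where
  "Omega = {(u, v). u > 2 \<and> u - 1 < v \<and> v < u\<^sup>2 / 4}"

definition sym_map :: "real \<times> real \<Rightarrow> real \<times> real" where
  "sym_map = (\<lambda>(x, y). (x + y, x * y))"

lemma bij_betw_sym_map: "bij_betw sym_map Tri Omega"
proof (rule bij_betw_imageI)
  show "inj_on sym_map Tri"
  proof (rule inj_onI, clarify)
    fix a b c d :: real
    assume T: "(a, b) \<in> Tri" "(c, d) \<in> Tri" and eq: "sym_map (a, b) = sym_map (c, d)"
    have s: "a + b = c + d" and p: "a * b = c * d"
      using eq by (auto simp: sym_map_def)
    have "(b - a)\<^sup>2 = (a + b)\<^sup>2 - 4 * (a * b)" by (simp add: power2_eq_square algebra_simps)
    also have "\<dots> = (c + d)\<^sup>2 - 4 * (c * d)" unfolding s p ..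
    also have "\<dots> = (d - c)\<^sup>2" by (simp add: power2_eq_square algebra_simps)
    finally have "b - a = d - c"
      using T by (auto simp: Tri_def intro: power2_eq_imp_eq)
    with s show "a = c \<and> b = d" by linarith
  qed
next
  show "sym_map ` Tri = Omega"
  proof (intro equalityI subsetI)
    fix p assume "p \<in> sym_map ` Tri"
    then obtain x y where xy: "1 < x" "x < y" and p: "p = (x + y, x * y)"
      by (auto simp: sym_map_def Tri_def)
    have "0 < (x - 1) * (y - 1)" "0 < (y - x)\<^sup>2" using xy by auto
    then show "p \<in> Omega"
      using xy unfolding p Omega_def by (simp add: power2_eq_square algebra_simps)
  next
    fix p assume "p \<in> Omega"
    then obtain u v where p: "p = (u, v)" and uv: "u > 2" "u - 1 < v" "v < u\<^sup>2 / 4"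
      by (auto simp: Omega_def)
    define r where "r = sqrt (u\<^sup>2 - 4 * v)"
    have r0: "r > 0" and r2: "r\<^sup>2 = u\<^sup>2 - 4 * v" using uv by (auto simp: r_def)
    have "r\<^sup>2 < (u - 2)\<^sup>2" using uv unfolding r2 by (simp add: power2_eq_square algebra_simps)
    then have "r < u - 2" using uv by (rule_tac power2_less_imp_less) simp_all
    then have "((u - r) / 2, (u + r) / 2) \<in> Tri" using r0 by (auto simp: Tri_def)
    moreover have "sym_map ((u - r) / 2, (u + r) / 2) = p"
      using r2 by (auto simp: sym_map_def p power2_eq_square field_simps)
    ultimately show "p \<in> sym_map ` Tri" by (metis image_eqI)
  qed
qed

text \<open>By the bijection above, \<open>the_inv_into Tri sym_map (u, v)\<close> is the unique point
  \<open>(x, y) \<in> Tri\<close> with \<open>u = x + y\<close> and \<open>v = x * y\<close>. The value \<open>0\<close> off \<open>Omega\<close> is a mere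
  convention, needed only on a null set.\<close>

definition W_weight :: "(real \<Rightarrow> real) \<Rightarrow> real \<Rightarrow> real \<times> real \<Rightarrow> real" where
  "W_weight w \<gamma> = (\<lambda>(u, v).
     if (u, v) \<in> Omega
     then (let (x, y) = the_inv_into Tri sym_map (u, v)
           in w x * w y * \<bar>u\<^sup>2 - 4 * v\<bar> powr \<gamma>)
     else 0)"

definition W_weight_ij :: "(real \<Rightarrow> real) \<Rightarrow> real \<Rightarrow> nat \<Rightarrow> nat \<Rightarrow> real \<times> real \<Rightarrow> real" where
  "W_weight_ij w \<gamma> i j = (\<lambda>(u, v). (1 - u + v) ^ i * (1 + u + v) ^ j * W_weight w \<gamma> (u, v))"

definition G :: "(real \<times> real) set" where
  "G = {..-1} \<times> {..-1} \<union> {1..} \<times> {1..}"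

definition G_weight :: "(real \<Rightarrow> real) \<Rightarrow> real \<Rightarrow> real \<times> real \<Rightarrow> real" where
  "G_weight w \<gamma> = (\<lambda>(x, y). W_weight w \<gamma> (2 * x * y, x\<^sup>2 + y\<^sup>2 - 1) * \<bar>x\<^sup>2 - y\<^sup>2\<bar>)"

end

theory Submission
  imports Defs
begin

text \<open>
  Put \<open>\<phi>(x, y) = (2 x y, x\<^sup>2 + y\<^sup>2 - 1)\<close>. With \<open>(u, v) = \<phi>(x, y)\<close> one has
  \<open>1 - u + v = (x - y)\<^sup>2\<close>, \<open>1 + u + v = (x + y)\<^sup>2\<close> and \<open>u\<^sup>2 - 4 v = 4 (x\<^sup>2 - 1) (y\<^sup>2 - 1)\<close>,
  so \<open>\<phi>\<close> maps \<open>Tri\<close> bijectively onto \<open>Omega\<close>, with Jacobian \<open>4 (y\<^sup>2 - x\<^sup>2)\<close>. The region \<open>G\<close>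
  consists, up to points where the weight vanishes, of the four images of \<open>Tri\<close> under the
  reflections \<open>(x, y) \<mapsto> (y, x)\<close> and \<open>(x, y) \<mapsto> (-y, -x)\<close>, which leave \<open>\<phi>\<close> invariant.

  Every polynomial is a sum of four terms \<open>(x - y)\<^sup>i (x + y)\<^sup>j (f \<circ> \<phi>)\<close> with \<open>i, j \<in> {0, 1}\<close>.
  Terms with distinct \<open>(i, j)\<close> have distinct parities under the reflections and are therefore
  orthogonal, while on terms with the same \<open>(i, j)\<close> the inner product over \<open>G\<close> becomes the
  inner product over \<open>Omega\<close> with weight \<open>(1 - u + v)\<^sup>i (1 + u + v)\<^sup>j W\<close>. Orthogonality of degree
  \<open>m\<close> thus splits into four conditions on the coefficients \<open>f\<close>: for \<open>m - i - j = 2 d\<close> the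
  coefficient is an orthogonal polynomial of degree \<open>d\<close>, and for odd \<open>m - i - j\<close> it is
  orthogonal to itself and vanishes.
\<close>

subsection \<open>Change of variables\<close>

text \<open>Agreement on boxes determines a Borel measure, so \<open>T\<close> carries
  \<open>lborel\<close> to \<open>lborel\<close>. Null sets are then respected as well, which
  extends measurability and the image measure to the completions.\<close>

lemma lborel_measure_preserving:
  fixes T :: "'a::euclidean_space \<Rightarrow> 'b::euclidean_space"
  assumes T: "continuous_on UNIV T"
    and box: "\<And>l u. (\<And>b. b \<in> Basis \<Longrightarrow> l \<bullet> b \<le> u \<bullet> b) \<Longrightarrow>
      emeasure lborel (T -` box l u) = (\<Prod>b\<in>Basis. (u - l) \<bullet> b)"
  shows "T \<in> lebesgue \<rightarrow>\<^sub>M lebesgue" and "distr lebesgue lebesgue T = lebesgue"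
proof -
  have m [measurable]: "T \<in> borel_measurable borel"
    using T by (rule borel_measurable_continuous_onI)
  have eq: "lborel = distr lborel borel T"
    by (rule lborel_eqI) (auto simp: emeasure_distr box)
  have 1: "distr lebesgue lborel T = lborel"
    using eq distr_completion[of T lborel lborel] by (simp cong: distr_cong)
  have m': "T \<in> lebesgue \<rightarrow>\<^sub>M lborel" by (simp add: measurable_completion)
  have ns: "null_sets (lborel::'b measure) = null_sets (distr lebesgue lborel T)" by (simp add: 1)
  show "T \<in> lebesgue \<rightarrow>\<^sub>M lebesgue"
    by (rule completion.measurable_completion2[OF m']) (simp add: ns)
  show "distr lebesgue lebesgue T = lebesgue"
    using completion.completion_distr_eq[OF m' ns[symmetric]] by (simp add: 1)
qed

lemma emeasure_box_plane:
  fixes a b c d :: real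
  assumes "a \<le> c" "b \<le> d"
  shows "emeasure lborel (box (a, b) (c, d)) = ennreal ((c - a) * (d - b))"
  using assms by (simp add: emeasure_lborel_box_eq Basis_prod_def prod.union_disjoint image_image)

text \<open>The preimage of a box is a box with the sides exchanged, and also negated for
  \<open>c = -1\<close>, so its area is unchanged.\<close>

lemma reflect_lebesgue:
  fixes c :: real
  assumes "c = 1 \<or> c = -1"
  defines "T \<equiv> (\<lambda>(x::real, y::real). (c * y, c * x))"
  shows "T \<in> lebesgue \<rightarrow>\<^sub>M lebesgue" and "distr lebesgue lebesgue T = lebesgue"
proof -
  have "continuous_on UNIV T" by (auto simp: T_def split_def intro!: continuous_intros)
  moreover have "emeasure lborel (T -` box l u) = (\<Prod>b\<in>Basis. (u - l) \<bullet> b)"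
    if lu: "\<And>b. b \<in> Basis \<Longrightarrow> l \<bullet> b \<le> u \<bullet> b" for l u
  proof -
    obtain a b c' d where l: "l = (a, b)" and u: "u = (c', d)" by (meson surj_pair)
    have le: "a \<le> c'" "b \<le> d"
      using lu[of "(1,0)"] lu[of "(0,1)"] by (auto simp: l u Basis_prod_def)
    have pr: "(\<Prod>b\<in>Basis. (u - l) \<bullet> b) = (c' - a) * (d - b)"
      by (simp add: l u Basis_prod_def prod.union_disjoint image_image)
    show ?thesis
    proof (cases "c = 1")
      case True
      have "T -` box l u = box (b, a) (d, c')"
        using True by (auto simp: T_def l u mem_box Basis_prod_def)
      then show ?thesis using pr emeasure_box_plane[of b d a c'] le by (simp add: mult.commute)
    next
      case False
      then have "T -` box l u = box (-d, -c') (-b, -a)"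
        using assms by (auto simp: T_def l u mem_box Basis_prod_def)
      then show ?thesis using pr emeasure_box_plane[of "-d" "-b" "-c'" "-a"] le by (simp add: mult.commute)
    qed
  qed
  ultimately show "T \<in> lebesgue \<rightarrow>\<^sub>M lebesgue" "distr lebesgue lebesgue T = lebesgue"
    using lborel_measure_preserving by blast+
qed

text \<open>The library's change of variables theorem lives on \<open>real ^ 2\<close>; it is transported to
  \<open>real \<times> real\<close> along this measure preserving bijection.\<close>

definition plane :: "real ^ 2 \<Rightarrow> real \<times> real" where
  "plane v = (v $ 1, v $ 2)"

lemma plane_lebesgue:
  shows "plane \<in> lebesgue \<rightarrow>\<^sub>M lebesgue" and "distr lebesgue lebesgue plane = lebesgue"
proof -
  have "continuous_on UNIV plane" by (auto simp: plane_def[abs_def] intro!: continuous_intros)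
  moreover have "emeasure lborel (plane -` box l u) = (\<Prod>b\<in>Basis. (u - l) \<bullet> b)"
    if lu: "\<And>b. b \<in> Basis \<Longrightarrow> l \<bullet> b \<le> u \<bullet> b" for l u
  proof -
    obtain a b c d where l: "l = (a, b)" and u: "u = (c, d)" by (meson surj_pair)
    have le: "a \<le> c" "b \<le> d"
      using lu[of "(1,0)"] lu[of "(0,1)"] by (auto simp: l u Basis_prod_def)
    have pr: "(\<Prod>b\<in>Basis. (u - l) \<bullet> b) = (c - a) * (d - b)"
      by (simp add: l u Basis_prod_def prod.union_disjoint image_image)
    have B: "Basis = {axis 1 1, axis 2 (1::real) :: real^2}"
      by (auto simp: Basis_vec_def UNIV_2)
    have "plane -` box l u = box (vector [a, b]) (vector [c, d])"
      by (auto simp: plane_def l u mem_box Basis_prod_def B inner_axis vector_2)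
    moreover have "emeasure lborel (box (vector [a, b]) (vector [c, d] :: real^2)) = (c - a) * (d - b)"
      using le by (simp add: emeasure_lborel_box_eq B inner_axis axis_eq_axis)
    ultimately show ?thesis using pr by simp
  qed
  ultimately show "plane \<in> lebesgue \<rightarrow>\<^sub>M lebesgue" "distr lebesgue lebesgue plane = lebesgue"
    using lborel_measure_preserving by blast+
qed

definition vec_of_plane :: "real \<times> real \<Rightarrow> real ^ 2" where
  "vec_of_plane p = vector [fst p, snd p]"

lemma plane_vec_of_plane [simp]: "plane (vec_of_plane p) = p"
  by (simp add: plane_def vec_of_plane_def)

text \<open>Supplies the measurable right inverse of \<open>plane\<close> that
  \<open>integral_measure_preserving\<close> asks for.\<close>

lemma vec_of_plane_lebesgue: "vec_of_plane \<in> lebesgue \<rightarrow>\<^sub>M lebesgue"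
proof -
  have B: "Basis = {axis 1 1, axis 2 (1::real) :: real^2}"
    by (auto simp: Basis_vec_def UNIV_2)
  have "continuous_on UNIV vec_of_plane"
    unfolding vec_of_plane_def[abs_def] vector_def
    by (subst continuous_on_componentwise)
      (auto simp: B inner_axis vec_of_plane_def simp flip: vector_def intro!: continuous_intros)
  moreover have "emeasure lborel (vec_of_plane -` box l u) = (\<Prod>b\<in>Basis. (u - l) \<bullet> b)"
    if lu: "\<And>b. b \<in> Basis \<Longrightarrow> l \<bullet> b \<le> u \<bullet> b" for l u
  proof -
    have le: "l $ 1 \<le> u $ 1" "l $ 2 \<le> u $ 2"
      using lu[of "axis 1 1"] lu[of "axis 2 1"] by (auto simp: B inner_axis)
    have "vec_of_plane -` box l u = box (l $ 1, l $ 2) (u $ 1, u $ 2)"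
      by (auto simp: vec_of_plane_def mem_box Basis_prod_def B inner_axis)
    then show ?thesis
      using emeasure_box_plane[OF le] by (simp add: B inner_axis axis_eq_axis)
  qed
  ultimately show ?thesis by (rule lborel_measure_preserving)
qed

text \<open>Composing with the measurable right inverse \<open>S\<close> recovers measurability of
  \<open>f\<close> from that of \<open>f \<circ> T\<close>, so integrability transfers in both
  directions; where it fails, both integrals are 0 by convention.\<close>

lemma integral_measure_preserving:
  fixes f :: "'b::euclidean_space \<Rightarrow> real"
  assumes T: "T \<in> lebesgue \<rightarrow>\<^sub>M lebesgue" "distr lebesgue lebesgue T = lebesgue"
    and S: "S \<in> lebesgue \<rightarrow>\<^sub>M lebesgue" "\<And>x. T (S x) = x"
  shows "integrable lebesgue (\<lambda>x. f (T x)) \<longleftrightarrow> integrable lebesgue f"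
    and "(LINT x|lebesgue. f (T x)) = (LINT x|lebesgue. f x)"
proof -
  have *: "f \<in> borel_measurable lebesgue" if "(\<lambda>x. f (T x)) \<in> borel_measurable lebesgue"
    using measurable_compose[OF S(1) that] S(2) by simp
  show 1: "integrable lebesgue (\<lambda>x. f (T x)) \<longleftrightarrow> integrable lebesgue f"
    using integrable_distr_eq[of T lebesgue lebesgue f] T *
    by (metis borel_measurable_integrable)
  show "(LINT x|lebesgue. f (T x)) = (LINT x|lebesgue. f x)"
  proof (cases "integrable lebesgue f")
    case True
    then show ?thesis
      using integral_distr[of T lebesgue lebesgue f] T by auto
  next
    case False
    then show ?thesis using 1 by (simp add: not_integrable_integral_eq)
  qed
qed

definition quad_map :: "real \<times> real \<Rightarrow> real \<times> real" where
  "quad_map = (\<lambda>(x, y). (2 * x * y, x\<^sup>2 + y\<^sup>2 - 1))"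

text \<open>Since \<open>1 + u + v = (x + y)^2\<close> and \<open>1 - u + v = (y - x)^2\<close>, and
  both \<open>x + y\<close> and \<open>y - x\<close> are positive on \<open>Tri\<close>, a point is
  recovered from its image by two square roots.\<close>

lemma bij_betw_quad_map: "bij_betw quad_map Tri Omega"
proof (rule bij_betw_imageI)
  show "inj_on quad_map Tri"
  proof (rule inj_onI, clarify)
    fix a b c d :: real
    assume T: "(a, b) \<in> Tri" "(c, d) \<in> Tri" and eq: "quad_map (a, b) = quad_map (c, d)"
    have "(a + b)\<^sup>2 = (c + d)\<^sup>2" "(b - a)\<^sup>2 = (d - c)\<^sup>2"
      using eq by (auto simp: quad_map_def power2_eq_square algebra_simps)
    then have "a + b = c + d" "b - a = d - c"
      using T by (auto simp: Tri_def intro: power2_eq_imp_eq)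
    then show "a = c \<and> b = d" by linarith
  qed
next
  show "quad_map ` Tri = Omega"
  proof (intro equalityI subsetI)
    fix p assume "p \<in> quad_map ` Tri"
    then obtain x y where xy: "1 < x" "x < y" and p: "p = (2 * x * y, x\<^sup>2 + y\<^sup>2 - 1)"
      by (auto simp: quad_map_def Tri_def)
    have x2: "1 < x\<^sup>2" and y2: "1 < y\<^sup>2" using xy by auto
    \<comment> \<open>This gives \<open>u > 2\<close>; the next two facts give
      \<open>v < u^2 / 4\<close> and \<open>u - 1 < v\<close>.\<close>
    have "1 < x * y" using less_1_mult[of x y] xy by simp
    moreover have "0 < (x\<^sup>2 - 1) * (y\<^sup>2 - 1)" using x2 y2 by simp
    moreover have "0 < (y - x)\<^sup>2" using xy by auto
    ultimately show "p \<in> Omega"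
      unfolding p Omega_def by (simp add: power2_eq_square algebra_simps)
  next
    fix p assume "p \<in> Omega"
    then obtain u v where p: "p = (u, v)" and uv: "u > 2" "u - 1 < v" "v < u\<^sup>2 / 4"
      by (auto simp: Omega_def)
    \<comment> \<open>\<open>s\<close> and \<open>d\<close> are to become \<open>x + y\<close> and
      \<open>y - x\<close>.\<close>
    define s where "s = sqrt (1 + u + v)"
    define d where "d = sqrt (1 - u + v)"
    have s2: "s\<^sup>2 = 1 + u + v" and d2: "d\<^sup>2 = 1 - u + v" and s0: "0 < s" and d0: "0 < d"
      using uv by (auto simp: s_def d_def)
    \<comment> \<open>Here \<open>(v - 1)^2 - (s * d)^2 = u^2 - 4 * v\<close>. As
      \<open>(s - d)^2 = 2 + 2 * v - 2 * s * d\<close>, the resulting bound on \<open>s * d\<close>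
      pushes the smaller coordinate \<open>(s - d) / 2\<close> above 1.\<close>
    have "(s * d)\<^sup>2 < (v - 1)\<^sup>2"
      using uv unfolding power_mult_distrib s2 d2 by (simp add: power2_eq_square field_simps)
    then have "s * d < v - 1"
      by (rule power2_less_imp_less) (use uv in simp)
    then have "2\<^sup>2 < (s - d)\<^sup>2" using s2 d2 by (simp add: power2_eq_square algebra_simps)
    moreover have "d < s" unfolding s_def d_def using uv by simp
    ultimately have "2 < s - d" by (rule_tac power2_less_imp_less) simp_all
    then have "((s - d) / 2, (s + d) / 2) \<in> Tri" using d0 by (auto simp: Tri_def)
    moreover have "quad_map ((s - d) / 2, (s + d) / 2) = p"
      using s2 d2 by (auto simp: quad_map_def p power2_eq_square field_simps)
    ultimately show "p \<in> quad_map ` Tri" by (metis image_eqI)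
  qed
qed

text \<open>The Jacobian determinant of \<open>quad_map\<close> is \<open>4 * (y^2 - x^2)\<close>,
  and the map is injective on \<open>Tri\<close> with image \<open>Omega\<close>.\<close>

lemma quad_map_change_of_variables:
  fixes h :: "real \<times> real \<Rightarrow> real"
  assumes "set_integrable lebesgue Omega h"
  shows "set_integrable lebesgue Tri (\<lambda>p. h (quad_map p) * \<bar>(fst p)\<^sup>2 - (snd p)\<^sup>2\<bar>)" (is ?int)
    and "4 * (LINT p:Tri|lebesgue. h (quad_map p) * \<bar>(fst p)\<^sup>2 - (snd p)\<^sup>2\<bar>) =
      (LINT p:Omega|lebesgue. h p)" (is ?eq)
proof -
  define g where "g v = vec_of_plane (quad_map (plane v))" for v
  define g' :: "real^2 \<Rightarrow> real^2 \<Rightarrow> real^2" where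
    "g' v k = vector [2 * (v $ 1 * k $ 2 + k $ 1 * v $ 2), 2 * (v $ 1 * k $ 1 + v $ 2 * k $ 2)]" for v k
  have B: "Basis = {axis 1 1, axis 2 (1::real) :: real^2}"
    by (auto simp: Basis_vec_def UNIV_2)
  let ?S = "plane -` Tri" and ?O = "plane -` Omega"
  have "open Tri"
  proof -
    have *: "Tri = {p. 1 < fst p} \<inter> {p. fst p < snd p}" by (auto simp: Tri_def)
    show ?thesis unfolding * by (intro open_Int open_Collect_less continuous_intros)
  qed
  then have Tri: "Tri \<in> sets lebesgue" by (metis borel_open sets_completionI_sets sets_lborel)
  then have S: "?S \<in> sets lebesgue"
    using measurable_sets[OF plane_lebesgue(1)] by fastforce
  have der: "(g has_derivative g' v) (at v within ?S)" for v
    unfolding has_derivative_componentwise_within[of g]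
    by (auto simp: B inner_axis g_def g'_def vec_of_plane_def quad_map_def plane_def power2_eq_square
        fun_eq_iff algebra_simps
        intro!: derivative_eq_intros bounded_linear_imp_has_derivative[OF bounded_linear_vec_nth])
  have img: "g ` ?S = ?O"
  proof (intro equalityI subsetI)
    fix v assume "v \<in> g ` ?S"
    then show "v \<in> ?O"
      using bij_betw_quad_map by (auto simp: g_def bij_betw_def)
  next
    fix v assume "v \<in> ?O"
    then obtain p where p: "p \<in> Tri" "quad_map p = plane v"
      using bij_betw_imp_surj_on[OF bij_betw_quad_map] by (metis imageE vimageD)
    have "vec_of_plane (plane v) = v"
      by (simp add: vec_of_plane_def plane_def vec_eq_iff forall_2)
    then have "g (vec_of_plane p) = v" using p by (simp add: g_def)
    then show "v \<in> g ` ?S" using p by (metis image_eqI plane_vec_of_plane vimageI)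
  qed
  have inj: "inj_on g ?S"
  proof (rule inj_onI)
    fix a b assume ab: "a \<in> ?S" "b \<in> ?S" "g a = g b"
    have "quad_map (plane a) = quad_map (plane b)"
      using ab(3) by (metis g_def plane_vec_of_plane)
    then have "plane a = plane b"
      using ab bij_betw_quad_map by (auto simp: bij_betw_def inj_on_def)
    then show "a = b" by (simp add: plane_def vec_eq_iff forall_2)
  qed
  have det: "\<bar>det (matrix (g' v))\<bar> = 4 * \<bar>(v $ 1)\<^sup>2 - (v $ 2)\<^sup>2\<bar>" for v
  proof -
    have "det (matrix (g' v)) = 4 * ((v $ 2)\<^sup>2 - (v $ 1)\<^sup>2)"
      by (simp add: det_2 matrix_def g'_def axis_def power2_eq_square algebra_simps)
    then show ?thesis by (auto simp: abs_if)
  qed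
  \<comment> \<open>Extension by zero turns the set integrals into integrals over the whole plane,
    where transport along \<open>plane\<close> applies.\<close>
  define F where "F p = indicator Omega p * h p" for p
  define K where "K p = indicator Tri p * (h (quad_map p) * \<bar>(fst p)\<^sup>2 - (snd p)\<^sup>2\<bar>)" for p
  note pres = integral_measure_preserving[OF plane_lebesgue vec_of_plane_lebesgue plane_vec_of_plane]
  have F: "(\<lambda>v. h (plane v)) absolutely_integrable_on ?O"
  proof -
    have "integrable lebesgue F" using assms by (simp add: set_integrable_def F_def[abs_def])
    then have "integrable lebesgue (\<lambda>v. F (plane v))" by (simp add: pres)
    then show ?thesis by (simp add: set_integrable_def F_def[abs_def] indicator_def)
  qed
  \<comment> \<open>The change of variables theorem is applied to vector-valued integrands, so the
    real integrand is viewed as one of dimension one.\<close>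
  let ?f = "\<lambda>v. vec (h (plane v)) :: real^1"
  define b where "b = integral ?O (\<lambda>v. h (plane v))"
  have "?f absolutely_integrable_on (g ` ?S) \<and> integral (g ` ?S) ?f = vec b"
    using F by (simp add: img absolutely_integrable_on_1_iff integral_on_1_eq b_def)
  then have "(\<lambda>x. \<bar>det (matrix (g' x))\<bar> *\<^sub>R ?f (g x)) absolutely_integrable_on ?S \<and>
      integral ?S (\<lambda>x. \<bar>det (matrix (g' x))\<bar> *\<^sub>R ?f (g x)) = vec b"
    by (subst has_absolute_integral_change_of_variables[OF S der inj]) 
  then have 1: "(\<lambda>v. 4 * (\<bar>(v $ 1)\<^sup>2 - (v $ 2)\<^sup>2\<bar> * h (quad_map (plane v)))) absolutely_integrable_on ?S"
      "integral ?S (\<lambda>v. 4 * (\<bar>(v $ 1)\<^sup>2 - (v $ 2)\<^sup>2\<bar> * h (quad_map (plane v)))) = b"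
    by (simp_all add: det g_def absolutely_integrable_on_1_iff integral_on_1_eq mult.assoc)
  have K4: "(\<lambda>v. indicator ?S v *\<^sub>R (4 * (\<bar>(v $ 1)\<^sup>2 - (v $ 2)\<^sup>2\<bar> * h (quad_map (plane v))))) =
      (\<lambda>v. 4 * K (plane v))"
    by (auto simp: K_def plane_def indicator_def)
  have "integrable lebesgue (\<lambda>v. 4 * K (plane v))"
    using 1(1) unfolding set_integrable_def K4 .
  then have "integrable lebesgue K" by (simp add: pres)
  then show ?int by (simp add: set_integrable_def K_def[abs_def])
  have "(LINT p:Omega|lebesgue. h p) = (LINT p|lebesgue. F p)"
    by (simp add: set_lebesgue_integral_def F_def[abs_def])
  also have "\<dots> = (LINT v|lebesgue. F (plane v))" by (simp add: pres)
  also have "\<dots> = (LINT v:?O|lebesgue. h (plane v))"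
    by (simp add: set_lebesgue_integral_def F_def[abs_def] indicator_def)
  also have "\<dots> = b" unfolding b_def by (rule set_lebesgue_integral_eq_integral[OF F])
  also have "\<dots> = (LINT v|lebesgue. 4 * K (plane v))"
    using set_lebesgue_integral_eq_integral(2)[OF 1(1)] 1(2)
    unfolding set_lebesgue_integral_def K4 by simp
  also have "\<dots> = 4 * (LINT p|lebesgue. K p)" by (simp add: pres)
  finally show ?eq by (simp add: set_lebesgue_integral_def K_def[abs_def])
qed

subsection \<open>Polynomials and orthonormal families\<close>

definition all_polys :: "(real \<times> real \<Rightarrow> real) set" where
  "all_polys = fun_span (range (\<lambda>(i, j). monomial i j))"

text \<open>The strict bound makes \<open>deg_less 0\<close> the zero space, so that degree -1 needs
  no separate treatment.\<close>

definition deg_less :: "nat \<Rightarrow> (real \<times> real \<Rightarrow> real) set" where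
  "deg_less m = fun_span {monomial i j |i j. i + j < m}"

lemma polys_eq_deg_less: "polys m = deg_less (Suc m)"
  by (simp add: polys_def deg_less_def less_Suc_eq_le)

lemma deg_less_0 [simp]: "deg_less 0 = {0}"
  by (simp add: deg_less_def)

lemma deg_less_mono: "m \<le> n \<Longrightarrow> deg_less m \<subseteq> deg_less n"
  unfolding deg_less_def by (rule fun_space.span_mono) (blast intro: less_le_trans)

lemma deg_less_subset_all_polys: "deg_less m \<subseteq> all_polys"
  unfolding deg_less_def all_polys_def by (rule fun_space.span_mono) auto

lemma subspace_deg_less: "fun_space.subspace (deg_less m)"
  unfolding deg_less_def by (rule fun_space.subspace_span)

lemma subspace_all_polys: "fun_space.subspace all_polys"
  unfolding all_polys_def by (rule fun_space.subspace_span)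

lemma monomial_in_deg_less: "i + j < m \<Longrightarrow> monomial i j \<in> deg_less m"
  unfolding deg_less_def by (rule fun_space.span_base) auto

lemma monomial_in_all_polys: "monomial i j \<in> all_polys"
  unfolding all_polys_def by (rule fun_space.span_base) auto

lemma monomial_mult: "(\<lambda>p. monomial i j p * monomial k l p) = monomial (i + k) (j + l)"
  by (simp add: fun_eq_iff monomial_def power_add)

text \<open>Multiplication is bilinear, so closure on generators extends to the spans, first in
  \<open>g\<close> for a fixed generator and then in \<open>f\<close>.\<close>

lemma span_mult:
  assumes f: "f \<in> fun_span A" and g: "g \<in> fun_span B" and V: "fun_space.subspace V"
    and AB: "\<And>a b. a \<in> A \<Longrightarrow> b \<in> B \<Longrightarrow> (\<lambda>p. a p * b p) \<in> V"
  shows "(\<lambda>p. f p * g p :: real) \<in> V"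
proof -
  have add: "(\<lambda>p. x p + y p) \<in> V" if "x \<in> V" "y \<in> V" for x y
    using fun_space.subspace_add[OF V that] by (simp add: plus_fun_def)
  have sc: "(\<lambda>p. c * x p) \<in> V" if "x \<in> V" for x c
    using fun_space.subspace_scale[OF V that] .
  have zero: "(\<lambda>p. 0) \<in> V"
    using fun_space.subspace_0[OF V] by (simp add: zero_fun_def)
  have 1: "(\<lambda>p. a p * g p) \<in> V" if a: "a \<in> A" for a
    using g
  proof (induction rule: fun_space.span_induct_alt)
    case base show ?case using zero by simp
  next
    case (step c x y)
    have "(\<lambda>p. c * (a p * x p) + a p * y p) \<in> V" using add sc AB a step by blast
    then show ?case by (simp add: algebra_simps)
  qed
  show ?thesis using f
  proof (induction rule: fun_space.span_induct_alt)
    case base show ?case using zero by simp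
  next
    case (step c x y)
    have "(\<lambda>p. c * (x p * g p) + y p * g p) \<in> V" using add sc 1 step by blast
    then show ?case by (simp add: algebra_simps)
  qed
qed

text \<open>A degree below \<open>m\<close> and a degree at most \<open>n\<close> add up to a degree
  below \<open>m + n\<close>; this asymmetric form includes \<open>m = 0\<close>.\<close>

lemma deg_less_mult:
  assumes "f \<in> deg_less m" "g \<in> deg_less (Suc n)"
  shows "(\<lambda>p. f p * g p) \<in> deg_less (m + n)"
proof (rule span_mult[OF assms[unfolded deg_less_def] subspace_deg_less])
  fix a b assume "a \<in> {monomial i j |i j. i + j < m}" "b \<in> {monomial i j |i j. i + j < Suc n}"
  then show "(\<lambda>p. a p * b p) \<in> deg_less (m + n)"
    by (auto simp: monomial_mult intro!: monomial_in_deg_less)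
qed

lemma all_polys_mult:
  assumes "f \<in> all_polys" "g \<in> all_polys"
  shows "(\<lambda>p. f p * g p) \<in> all_polys"
proof (rule span_mult[OF assms[unfolded all_polys_def] subspace_all_polys])
  fix a b assume "a \<in> range (\<lambda>(i, j). monomial i j)" "b \<in> range (\<lambda>(i, j). monomial i j)"
  then show "(\<lambda>p. a p * b p) \<in> all_polys"
    by (auto simp: monomial_mult intro!: monomial_in_all_polys)
qed

lemma all_polys_eq_UN: "all_polys = (\<Union>m. deg_less m)"
proof
  show "(\<Union>m. deg_less m) \<subseteq> all_polys" using deg_less_subset_all_polys by blast
  show "all_polys \<subseteq> (\<Union>m. deg_less m)"
  proof
    fix f assume "f \<in> all_polys"
    then show "f \<in> (\<Union>m. deg_less m)"
      unfolding all_polys_def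
    proof (induction rule: fun_space.span_induct_alt)
      case base
      then show ?case by (auto intro!: exI[of _ 0] simp: zero_fun_def)
    next
      case (step c x y)
      then obtain i j m where x: "x = monomial i j" and y: "y \<in> deg_less m" by auto
      let ?n = "max m (Suc (i + j))"
      have "x \<in> deg_less ?n" unfolding x by (rule monomial_in_deg_less) simp
      moreover have "y \<in> deg_less ?n" using y deg_less_mono[of m ?n] by auto
      ultimately have "(\<lambda>p. c * x p) + y \<in> deg_less ?n"
        using subspace_deg_less fun_space.subspace_add fun_space.subspace_scale by blast
      then show ?case by blast
    qed
  qed
qed

section \<open>Moments and inner products of polynomials\<close>

lemma finite_moments_integrable:
  assumes "finite_moments D W" "f \<in> all_polys"
  shows "set_integrable lebesgue D (\<lambda>p. f p * W p)"
  using assms(2) unfolding all_polys_def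
proof (induction rule: fun_space.span_induct_alt)
  case base show ?case by (simp add: set_integrable_def)
next
  case (step c x y)
  then obtain i j where x: "x = monomial i j" by auto
  have "set_integrable lebesgue D (\<lambda>p. c * (x p * W p) + y p * W p)"
    using assms(1) step.IH unfolding x finite_moments_def by (intro set_integral_add) auto
  then show ?case by (simp add: algebra_simps)
qed

lemma ip_integrable:
  assumes "finite_moments D W" "f \<in> all_polys" "g \<in> all_polys"
  shows "set_integrable lebesgue D (\<lambda>p. f p * g p * W p)"
  using finite_moments_integrable[OF assms(1) all_polys_mult[OF assms(2,3)]] .

lemma ip_commute: "ip D W f g = ip D W g f"
  by (simp add: ip_def mult.commute)

lemma ip_add_left:
  assumes "finite_moments D W" "f \<in> all_polys" "g \<in> all_polys" "h \<in> all_polys"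
  shows "ip D W (f + g) h = ip D W f h + ip D W g h"
  using set_integral_add(2)[OF ip_integrable[OF assms(1,2,4)] ip_integrable[OF assms(1,3,4)]]
  unfolding ip_def by (simp add: distrib_right)

lemma ip_scale_left: "ip D W (\<lambda>p. c * f p) h = c * ip D W f h"
  unfolding ip_def by (simp add: mult.assoc)

lemma ip_zero_left [simp]: "ip D W 0 h = 0"
  by (simp add: ip_def)

lemma ip_zero_right [simp]: "ip D W h 0 = 0"
  by (simp add: ip_def)

lemma ip_sum_left:
  assumes "finite_moments D W" "h \<in> all_polys" "\<And>i. i \<in> I \<Longrightarrow> f i \<in> all_polys"
  shows "ip D W (\<Sum>i\<in>I. f i) h = (\<Sum>i\<in>I. ip D W (f i) h)"
  using assms(3)
proof (induction I rule: infinite_finite_induct)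
  case (insert x F)
  have "(\<Sum>i\<in>F. f i) \<in> all_polys"
    using insert.prems by (intro fun_space.subspace_sum[OF subspace_all_polys]) auto
  then show ?case
    using insert ip_add_left[OF assms(1) _ _ assms(2), of "f x" "sum f F"] by (simp add: plus_fun_def)
qed auto

text \<open>The guard for \<open>m = 0\<close> is absorbed: the only test polynomial in
  \<open>deg_less 0\<close> is 0.\<close>

lemma orth_polys_eq:
  "orth_polys D W m = {f \<in> deg_less (Suc m). \<forall>q\<in>deg_less m. ip D W f q = 0}"
  by (cases m) (auto simp: orth_polys_def polys_eq_deg_less)

text \<open>Pairing a linear relation with \<open>f j\<close> isolates the coefficient of
  \<open>f j\<close>, which gives independence. Equal values at distinct indices would make one
  inner product both 0 and 1.\<close>

lemma orthonormal_family_basis: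
  assumes fin: "finite I" and mom: "finite_moments D W"
    and f: "\<And>i. i \<in> I \<Longrightarrow> f i \<in> all_polys"
    and on: "\<And>i j. i \<in> I \<Longrightarrow> j \<in> I \<Longrightarrow> ip D W (f i) (f j) = (if i = j then 1 else 0)"
    and span: "fun_span (f ` I) = orth_polys D W m"
  shows "mutually_orthogonal_basis D W m I f"
proof -
  have inj: "inj_on f I"
    using on by (intro inj_onI) (metis zero_neq_one)
  have "\<not> fun_dependent (f ` I)"
  proof (subst fun_space.dependent_finite)
    show "finite (f ` I)" using fin by simp
    show "\<not> (\<exists>u. (\<exists>v\<in>f ` I. u v \<noteq> 0) \<and> (\<Sum>v\<in>f ` I. (\<lambda>x. u v * v x)) = 0)"
    proof clarify
      fix u j assume z: "(\<Sum>v\<in>f ` I. (\<lambda>x. u v * v x)) = 0" and j: "j \<in> I" "u (f j) \<noteq> 0"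
      have "0 = ip D W (\<Sum>i\<in>I. (\<lambda>x. u (f i) * f i x)) (f j)"
        using z by (simp add: sum.reindex[OF inj])
      also have "\<dots> = (\<Sum>i\<in>I. ip D W (\<lambda>x. u (f i) * f i x) (f j))"
        using f j by (intro ip_sum_left mom fun_space.subspace_scale[OF subspace_all_polys]) auto
      also have "\<dots> = (\<Sum>i\<in>I. if i = j then u (f j) else 0)"
        by (intro sum.cong) (auto simp: ip_scale_left on j)
      also have "\<dots> = u (f j)" using fin j by simp
      finally show False using j by simp
    qed
  qed
  then show ?thesis
    using inj span on by (simp add: mutually_orthogonal_basis_def is_basis_def)
qed

lemma orthonormal_basis_ip:
  assumes "orthonormal_basis D W n I f" "i \<in> I" "j \<in> I"
  shows "ip D W (f i) (f j) = (if i = j then 1 else 0)"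
  using assms by (auto simp: orthonormal_basis_def mutually_orthogonal_basis_def)

lemma orthonormal_basis_span:
  assumes "orthonormal_basis D W n I f"
  shows "fun_span (f ` I) = orth_polys D W n"
  using assms by (auto simp: orthonormal_basis_def mutually_orthogonal_basis_def is_basis_def)

text \<open>A polynomial of degree at most \<open>d\<close> orthogonal to all such polynomials lies in
  \<open>orth_polys D W d\<close>, and its coordinates in the orthonormal basis of that space vanish.\<close>

lemma orthonormal_bases_nondegenerate:
  assumes mom: "finite_moments D W"
    and on: "\<And>n. orthonormal_basis D W n {..n} (\<lambda>k. P k n)"
    and f: "f \<in> deg_less m" "\<And>q. q \<in> deg_less m \<Longrightarrow> ip D W f q = 0"
  shows "f = 0"
proof (cases m)
  case 0
  then show ?thesis using f by simp
next
  case (Suc d)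
  let ?B = "(\<lambda>k. P k d) ` {..d}"
  have inj: "inj_on (\<lambda>k. P k d) {..d}"
    using on[of d] by (simp add: orthonormal_basis_def mutually_orthogonal_basis_def is_basis_def)
  have B: "fun_span ?B = orth_polys D W d"
    using on[of d] by (rule orthonormal_basis_span)
  have "f \<in> orth_polys D W d"
    using f Suc deg_less_mono[of d "Suc d"] by (auto simp: orth_polys_eq)
  then have "f \<in> range (\<lambda>u. \<Sum>v\<in>?B. (\<lambda>x. u v * v x))"
    using fun_space.span_finite[of ?B] B by simp
  then obtain u where "f = (\<Sum>v\<in>?B. (\<lambda>x. u v * v x))" by blast
  then have u: "f = (\<Sum>k\<in>{..d}. (\<lambda>x. u (P k d) * P k d x))" by (simp add: sum.reindex[OF inj])
  have Pd: "P k d \<in> deg_less m" if "k \<le> d" for k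
    using that B fun_space.span_base[of "P k d" ?B] by (auto simp: orth_polys_eq Suc)
  then have Pa: "P k d \<in> all_polys" if "k \<le> d" for k
    using that deg_less_subset_all_polys by blast
  have "u (P j d) = 0" if j: "j \<le> d" for j
  proof -
    have "0 = ip D W f (P j d)" using f Pd j by simp
    also have "\<dots> = (\<Sum>k\<in>{..d}. ip D W (\<lambda>x. u (P k d) * P k d x) (P j d))"
      unfolding u using Pa j
      by (intro ip_sum_left mom fun_space.subspace_scale[OF subspace_all_polys]) auto
    also have "\<dots> = (\<Sum>k\<in>{..d}. if k = j then u (P j d) else 0)"
      by (intro sum.cong) (auto simp: ip_scale_left orthonormal_basis_ip[OF on] j)
    also have "\<dots> = u (P j d)" using j by simp
    finally show ?thesis by simp
  qed
  then show ?thesis unfolding u by (simp add: fun_eq_iff zero_fun_def)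
qed

subsection \<open>Symmetries of the region\<close>

text \<open>\<open>v < u^2 / 4\<close> amounts to \<open>(x^2 - 1) * (y^2 - 1) > 0\<close>, and
  \<open>u - 1 < v\<close> to \<open>x \<noteq> y\<close>. Such points of \<open>G\<close> thus
  avoid its edges and the diagonal, so each lies in exactly one reflected copy of
  \<open>Tri\<close>.\<close>

lemma quad_map_in_Omega:
  assumes "p \<in> G" "quad_map p \<in> Omega"
  shows "1 < \<bar>fst p\<bar>" "1 < \<bar>snd p\<bar>" "fst p \<noteq> snd p"
proof -
  obtain x y where p: "p = (x, y)" by fastforce
  have 1: "1 \<le> \<bar>x\<bar>" "1 \<le> \<bar>y\<bar>" using assms(1) by (auto simp: p G_def)
  have O: "2 * x * y - 1 < x\<^sup>2 + y\<^sup>2 - 1" "x\<^sup>2 + y\<^sup>2 - 1 < (2 * x * y)\<^sup>2 / 4"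
    using assms(2) by (auto simp: p quad_map_def Omega_def)
  then have "(x\<^sup>2 - 1) * (y\<^sup>2 - 1) > 0" by (simp add: power2_eq_square field_simps)
  then have "x\<^sup>2 \<noteq> 1" "y\<^sup>2 \<noteq> 1" by auto
  then have "\<bar>x\<bar> \<noteq> 1" "\<bar>y\<bar> \<noteq> 1" by (metis power2_abs one_power2)+
  with 1 show "1 < \<bar>fst p\<bar>" "1 < \<bar>snd p\<bar>" by (auto simp: p)
  show "fst p \<noteq> snd p" using O(1) by (auto simp: p power2_eq_square)
qed

text \<open>\<open>reflect 1\<close> is the reflection in the diagonal and
  \<open>reflect (-1)\<close> the one in the antidiagonal; their composite is the half-turn.\<close>

definition reflect :: "real \<Rightarrow> real \<times> real \<Rightarrow> real \<times> real" where
  "reflect c = (\<lambda>(x, y). (c * y, c * x))"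

lemma integral_reflect:
  fixes f :: "real \<times> real \<Rightarrow> real"
  assumes "c = 1 \<or> c = -1"
  shows "integrable lebesgue (\<lambda>p. f (reflect c p)) \<longleftrightarrow> integrable lebesgue f"
    and "(LINT p|lebesgue. f (reflect c p)) = (LINT p|lebesgue. f p)"
proof -
  have "reflect c (reflect c p) = p" for p
    using assms by (auto simp: reflect_def split_def)
  then show "integrable lebesgue (\<lambda>p. f (reflect c p)) \<longleftrightarrow> integrable lebesgue f"
    "(LINT p|lebesgue. f (reflect c p)) = (LINT p|lebesgue. f p)"
    using integral_measure_preserving[OF reflect_lebesgue[OF assms] reflect_lebesgue(1)[OF assms], of f]
    unfolding reflect_def by auto
qed

text \<open>Only \<open>c = 1\<close> changes the sign of \<open>x - y\<close>, and only
  \<open>c = -1\<close> that of \<open>x + y\<close>. These two signs tell the four parities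
  apart.\<close>

lemma reflect_simps:
  assumes "c = 1 \<or> c = -1"
  shows "quad_map (reflect c p) = quad_map p"
    and "\<bar>(fst (reflect c p))\<^sup>2 - (snd (reflect c p))\<^sup>2\<bar> = \<bar>(fst p)\<^sup>2 - (snd p)\<^sup>2\<bar>"
    and "reflect c p \<in> G \<longleftrightarrow> p \<in> G"
    and "fst (reflect c p) - snd (reflect c p) = - c * (fst p - snd p)"
    and "fst (reflect c p) + snd (reflect c p) = c * (fst p + snd p)"
  using assms
  by (cases p; auto simp: reflect_def quad_map_def G_def abs_minus_commute algebra_simps)+

text \<open>The four copies of \<open>Tri\<close> contribute equally, which accounts for the factor
  4 in \<open>quad_map_change_of_variables\<close>.\<close>

lemma integral_over_G:
  fixes h :: "real \<times> real \<Rightarrow> real"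
  assumes h: "set_integrable lebesgue Omega h" and h0: "\<And>p. p \<notin> Omega \<Longrightarrow> h p = 0"
  shows "set_integrable lebesgue G (\<lambda>p. h (quad_map p) * \<bar>(fst p)\<^sup>2 - (snd p)\<^sup>2\<bar>)" (is ?int)
    and "(LINT p:G|lebesgue. h (quad_map p) * \<bar>(fst p)\<^sup>2 - (snd p)\<^sup>2\<bar>) = (LINT p:Omega|lebesgue. h p)"
      (is ?eq)
proof -
  define H where "H p = h (quad_map p) * \<bar>(fst p)\<^sup>2 - (snd p)\<^sup>2\<bar>" for p
  define K where "K p = indicator Tri p *\<^sub>R H p" for p
  have Hs: "H (reflect c p) = H p" if "c = 1 \<or> c = -1" for c p
    using reflect_simps(1,2)[OF that] by (simp add: H_def)
  \<comment> \<open>This identity is pointwise. Both sides vanish if \<open>quad_map p\<close> is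
    outside \<open>Omega\<close>; otherwise \<open>p\<close> lies in exactly one of the four copies
    if it is in \<open>G\<close>, and in none if it is not.\<close>
  have split: "indicator G p *\<^sub>R H p =
      K p + K (reflect 1 p) + K (reflect (-1) p) + K (reflect 1 (reflect (-1) p))" for p
  proof (cases "quad_map p \<in> Omega")
    case False
    then show ?thesis by (simp add: K_def Hs) (simp add: H_def h0)
  next
    case True
    have "indicator G p = (indicator Tri p + indicator Tri (reflect 1 p) + indicator Tri (reflect (-1) p)
        + indicator Tri (reflect 1 (reflect (-1) p)) :: real)"
    proof (cases "p \<in> G")
      case False
      then show ?thesis by (auto simp: indicator_def Tri_def reflect_def G_def split: prod.splits)
    next
      case G: True
      show ?thesis using quad_map_in_Omega[OF G True] G
        by (auto simp: indicator_def Tri_def reflect_def G_def split: prod.splits)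
    qed
    then show ?thesis by (simp add: K_def Hs distrib_right)
  qed
  have K: "integrable lebesgue K" "4 * (LINT p|lebesgue. K p) = (LINT p:Omega|lebesgue. h p)"
    using quad_map_change_of_variables[OF h]
    by (simp_all add: set_integrable_def set_lebesgue_integral_def K_def[abs_def] H_def)
  have K1: "integrable lebesgue (\<lambda>p. K (reflect 1 p))" "integrable lebesgue (\<lambda>p. K (reflect (-1) p))"
    "integrable lebesgue (\<lambda>p. K (reflect 1 (reflect (-1) p)))"
    using K(1) integral_reflect(1)[of 1 K] integral_reflect(1)[of "-1" K]
      integral_reflect(1)[of "-1" "\<lambda>p. K (reflect 1 p)"] by simp_all
  have K2: "(LINT p|lebesgue. K (reflect 1 p)) = (LINT p|lebesgue. K p)"
    "(LINT p|lebesgue. K (reflect (-1) p)) = (LINT p|lebesgue. K p)"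
    "(LINT p|lebesgue. K (reflect 1 (reflect (-1) p))) = (LINT p|lebesgue. K p)"
    using integral_reflect(2)[of 1 K] integral_reflect(2)[of "-1" K] integral_reflect(2)[of "-1" "\<lambda>p. K (reflect 1 p)"]
    by simp_all
  show ?int
    using K(1) K1 unfolding set_integrable_def H_def[symmetric] split by simp
  have "(LINT p:G|lebesgue. H p) = 4 * (LINT p|lebesgue. K p)"
    using K(1) K1 K2 unfolding set_lebesgue_integral_def split by simp
  then show ?eq using K(2) by (simp add: H_def)
qed

text \<open>The reflection preserves Lebesgue measure and \<open>G\<close>, so the integral equals
  its own negative. This includes non-integrable integrands, whose integral is 0.\<close>

lemma integral_G_odd:
  fixes F :: "real \<times> real \<Rightarrow> real"
  assumes c: "c = 1 \<or> c = -1" and F: "\<And>p. F (reflect c p) = - F p"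
  shows "(LINT p:G|lebesgue. F p) = 0"
proof -
  have "(LINT p|lebesgue. indicator G p *\<^sub>R F p) =
      (LINT p|lebesgue. indicator G (reflect c p) *\<^sub>R F (reflect c p))"
    using integral_reflect(2)[OF c, of "\<lambda>p. indicator G p *\<^sub>R F p"] by simp
  also have "\<dots> = (LINT p|lebesgue. - (indicator G p *\<^sub>R F p))"
    using reflect_simps(3)[OF c] by (simp add: F indicator_def)
  also have "\<dots> = - (LINT p|lebesgue. indicator G p *\<^sub>R F p)"
    by (rule Bochner_Integration.integral_minus)
  finally show ?thesis by (simp add: set_lebesgue_integral_def)
qed

section \<open>Polynomials pulled back along \<open>quad_map\<close>\<close>

definition lift :: "nat \<times> nat \<Rightarrow> (real \<times> real \<Rightarrow> real) \<Rightarrow> real \<times> real \<Rightarrow> real" where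
  "lift t f p = (fst p - snd p) ^ fst t * (fst p + snd p) ^ snd t * f (quad_map p)"

text \<open>The square of the prefactor of \<open>lift t\<close>, written in the coordinates of
  \<open>Omega\<close>. Multiplying \<open>W_weight\<close> by it yields
  \<open>W_weight_ij\<close>.\<close>

definition factor :: "nat \<times> nat \<Rightarrow> real \<times> real \<Rightarrow> real" where
  "factor t p = (1 - fst p + snd p) ^ fst t * (1 + fst p + snd p) ^ snd t"

lemma factor_quad_map:
  "factor t (quad_map p) = ((fst p - snd p) ^ fst t * (fst p + snd p) ^ snd t)\<^sup>2"
proof -
  have "1 - fst (quad_map p) + snd (quad_map p) = (fst p - snd p)\<^sup>2"
    "1 + fst (quad_map p) + snd (quad_map p) = (fst p + snd p)\<^sup>2"
    by (auto simp: quad_map_def split_def power2_eq_square algebra_simps)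
  then show ?thesis
    by (simp add: factor_def power_mult_distrib flip: power_mult) (simp add: mult.commute)
qed

lemma deg_less_const: "0 < m \<Longrightarrow> (\<lambda>p. c) \<in> deg_less m"
  using fun_space.subspace_scale[OF subspace_deg_less monomial_in_deg_less[of 0 0 m], of c]
  by (simp add: monomial_def split_def)

lemma deg_less_fst: "1 < m \<Longrightarrow> fst \<in> deg_less m"
proof -
  have "monomial 1 0 = fst" by (simp add: fun_eq_iff monomial_def)
  then show "1 < m \<Longrightarrow> fst \<in> deg_less m" using monomial_in_deg_less[of 1 0 m] by simp
qed

lemma deg_less_snd: "1 < m \<Longrightarrow> snd \<in> deg_less m"
proof -
  have "monomial 0 1 = snd" by (simp add: fun_eq_iff monomial_def)
  then show "1 < m \<Longrightarrow> snd \<in> deg_less m" using monomial_in_deg_less[of 0 1 m] by simp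
qed

lemma deg_less_add: "f \<in> deg_less m \<Longrightarrow> g \<in> deg_less m \<Longrightarrow> (\<lambda>p. f p + g p) \<in> deg_less m"
  using fun_space.subspace_add[OF subspace_deg_less] by (simp add: plus_fun_def)

lemma deg_less_diff: "f \<in> deg_less m \<Longrightarrow> g \<in> deg_less m \<Longrightarrow> (\<lambda>p. f p - g p) \<in> deg_less m"
  using fun_space.subspace_diff[OF subspace_deg_less] by (simp add: fun_diff_def)

lemma deg_less_scale: "f \<in> deg_less m \<Longrightarrow> (\<lambda>p. c * f p) \<in> deg_less m"
  using fun_space.subspace_scale[OF subspace_deg_less] .

lemma deg_less_power:
  "f \<in> deg_less (Suc n) \<Longrightarrow> (\<lambda>p. f p ^ k) \<in> deg_less (Suc (n * k))"
proof (induction k)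
  case (Suc k)
  then show ?case using deg_less_mult[of "\<lambda>p. f p ^ k" "Suc (n * k)" f n] by (simp add: ac_simps)
qed (simp add: deg_less_const)

lemma deg_less_mem_mono: "f \<in> deg_less m \<Longrightarrow> m \<le> n \<Longrightarrow> f \<in> deg_less n"
  using deg_less_mono by blast

lemma factor_in_all_polys: "factor t \<in> all_polys"
proof -
  have "(\<lambda>p. 1 - fst p + snd p) \<in> deg_less 2" "(\<lambda>p. 1 + fst p + snd p) \<in> deg_less 2"
    by (auto intro!: deg_less_add deg_less_diff deg_less_const deg_less_fst deg_less_snd)
  then have "(\<lambda>p. (1 - fst p + snd p) ^ fst t) \<in> all_polys" "(\<lambda>p. (1 + fst p + snd p) ^ snd t) \<in> all_polys"
    using deg_less_power[of _ 1] deg_less_subset_all_polys by (auto simp: numeral_2_eq_2)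
  then show ?thesis unfolding factor_def[abs_def] by (rule all_polys_mult)
qed

text \<open>Composition with \<open>quad_map\<close> at most doubles the degree, and the prefactor
  adds \<open>fst t + snd t\<close>. The bound on \<open>f\<close> is the number of \<open>d\<close>
  with \<open>2 * d + fst t + snd t < m\<close>.\<close>

lemma lift_in_deg_less:
  assumes f: "f \<in> deg_less ((m + 1 - fst t - snd t) div 2)"
  shows "lift t f \<in> deg_less m"
proof -
  define k where "k = (m + 1 - fst t - snd t) div 2"
  have e: "(\<lambda>p. (fst p - snd p) ^ fst t * (fst p + snd p) ^ snd t) \<in> deg_less (Suc (fst t + snd t))"
    using deg_less_mult[OF deg_less_power[of "\<lambda>p. fst p - snd p" 1 "fst t"] deg_less_power[of "\<lambda>p. fst p + snd p" 1 "snd t"]]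
    by (simp add: deg_less_add deg_less_diff deg_less_fst deg_less_snd)
  have f: "f \<in> fun_span {monomial i j |i j. i + j < k}" using f by (simp add: k_def deg_less_def)
  show ?thesis using f
  proof (induction rule: fun_space.span_induct_alt)
    case base
    then show ?case
      using fun_space.subspace_0[OF subspace_deg_less] by (simp add: lift_def[abs_def] zero_fun_def)
  next
    case (step c x y)
    then obtain i j where x: "x = monomial i j" and ij: "i + j < k" by auto
    have 1: "(\<lambda>p. 2 * fst p * snd p) \<in> deg_less (Suc 2)"
      using deg_less_mult[OF deg_less_scale[OF deg_less_fst[of 2]] deg_less_snd[of "Suc 1"], of 2]
      by (simp add: numeral_3_eq_3)
    have 2: "(\<lambda>p. (fst p)\<^sup>2 + (snd p)\<^sup>2 - 1) \<in> deg_less (Suc 2)"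
      using deg_less_power[OF deg_less_fst[of "Suc 1"], of 2] deg_less_power[OF deg_less_snd[of "Suc 1"], of 2]
      by (auto intro!: deg_less_add deg_less_diff deg_less_const deg_less_fst deg_less_snd)
    have "(\<lambda>p. x (quad_map p)) = (\<lambda>p. (2 * fst p * snd p) ^ i * ((fst p)\<^sup>2 + (snd p)\<^sup>2 - 1) ^ j)"
      by (simp add: x monomial_def quad_map_def split_def)
    then have "(\<lambda>p. x (quad_map p)) \<in> deg_less (Suc (2 * i + 2 * j))"
      using deg_less_mult[OF deg_less_power[OF 1, of i] deg_less_power[OF 2, of j]] by simp
    then have "lift t x \<in> deg_less (Suc (fst t + snd t) + (2 * i + 2 * j))"
      using deg_less_mult[OF e] unfolding lift_def[abs_def] by blast
    then have lx: "lift t x \<in> deg_less m"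
      by (rule deg_less_mem_mono) (use ij in \<open>simp add: k_def\<close>)
    have "lift t ((\<lambda>p. c * x p) + y) = (\<lambda>p. c * lift t x p + lift t y p)"
      by (simp add: lift_def[abs_def] algebra_simps)
    then show ?case by (metis deg_less_add[OF deg_less_scale[OF lx] step.IH])
  qed
qed

lemma lift_in_all_polys:
  assumes "f \<in> all_polys"
  shows "lift t f \<in> all_polys"
proof -
  obtain m where m: "f \<in> deg_less m" using assms by (auto simp: all_polys_eq_UN)
  have "f \<in> deg_less ((2 * m + fst t + snd t + 1 - fst t - snd t) div 2)"
    using m by (rule deg_less_mem_mono) simp
  from lift_in_deg_less[of f "2 * m + fst t + snd t" t] this
  show ?thesis using deg_less_subset_all_polys by auto
qed

subsection \<open>Decomposition by parity\<close>

definition parities :: "(nat \<times> nat) set" where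
  "parities = {0, 1} \<times> {0, 1}"

lemma sum_parities: "(\<Sum>t\<in>parities. F t) = F (0, 0) + F (0, 1) + F (1, 0) + F (1, 1)"
proof -
  have *: "parities = {(0, 0), (0, 1), (1, 0), (1, 1)}" by (auto simp: parities_def)
  show ?thesis unfolding * by (simp add: add.assoc)
qed

text \<open>The decomposition into four parities with control of the degrees;
  \<open>deg_less_eq_lifts\<close> shows that it describes all of \<open>deg_less m\<close>.\<close>

definition lifts :: "nat \<Rightarrow> (real \<times> real \<Rightarrow> real) set" where
  "lifts m = {(\<lambda>p. \<Sum>t\<in>parities. lift t (f t) p) |f.
     \<forall>t\<in>parities. f t \<in> deg_less ((m + 1 - fst t - snd t) div 2)}"

lemma lifts_lincomb:
  assumes "f \<in> lifts m" "g \<in> lifts m"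
  shows "(\<lambda>p. c * f p + d * g p) \<in> lifts m"
proof -
  obtain a where a: "\<And>t. t \<in> parities \<Longrightarrow> a t \<in> deg_less ((m + 1 - fst t - snd t) div 2)"
    and f: "f = (\<lambda>p. \<Sum>t\<in>parities. lift t (a t) p)"
    using assms(1) by (auto simp: lifts_def)
  obtain b where b: "\<And>t. t \<in> parities \<Longrightarrow> b t \<in> deg_less ((m + 1 - fst t - snd t) div 2)"
    and g: "g = (\<lambda>p. \<Sum>t\<in>parities. lift t (b t) p)"
    using assms(2) by (auto simp: lifts_def)
  have "(\<lambda>p. c * f p + d * g p) = (\<lambda>p. \<Sum>t\<in>parities. lift t (\<lambda>p. c * a t p + d * b t p) p)"
    unfolding f g by (simp add: lift_def sum_distrib_left sum.distrib algebra_simps)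
  moreover have "(\<lambda>p. c * a t p + d * b t p) \<in> deg_less ((m + 1 - fst t - snd t) div 2)"
    if "t \<in> parities" for t
    using a[OF that] b[OF that] by (intro deg_less_add deg_less_scale)
  ultimately show ?thesis unfolding lifts_def
    by (intro CollectI exI[of _ "\<lambda>t p. c * a t p + d * b t p"]) auto
qed

lemma lifts_mono:
  assumes "f \<in> lifts m" "m \<le> n"
  shows "f \<in> lifts n"
proof -
  obtain a where a: "\<And>t. t \<in> parities \<Longrightarrow> a t \<in> deg_less ((m + 1 - fst t - snd t) div 2)"
    and f: "f = (\<lambda>p. \<Sum>t\<in>parities. lift t (a t) p)"
    using assms(1) by (auto simp: lifts_def)
  have "a t \<in> deg_less ((n + 1 - fst t - snd t) div 2)" if "t \<in> parities" for t
    using a[OF that] by (rule deg_less_mem_mono) (use assms(2) in \<open>intro div_le_mono diff_le_mono; simp\<close>)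
  then show ?thesis unfolding lifts_def f by blast
qed

text \<open>The factor \<open>x + y\<close> toggles the second exponent. Exponent 0 becomes 1 with
  the same coefficient; exponent 1 produces the square \<open>1 + u + v\<close>, which moves into
  the coefficient and raises its degree bound by one.\<close>

lemma lifts_sum:
  assumes "f \<in> lifts (Suc m)"
  shows "(\<lambda>p. (fst p + snd p) * f p) \<in> lifts (Suc (Suc m))"
proof -
  obtain a where a: "\<And>t. t \<in> parities \<Longrightarrow> a t \<in> deg_less ((Suc m + 1 - fst t - snd t) div 2)"
    and f: "f = (\<lambda>p. \<Sum>t\<in>parities. lift t (a t) p)"
    using assms by (auto simp: lifts_def)
  define L :: "real \<times> real \<Rightarrow> real" where "L p = 1 + fst p + snd p" for p
  have L: "L \<in> deg_less (Suc 1)"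
    unfolding L_def[abs_def] by (intro deg_less_add deg_less_const deg_less_fst deg_less_snd) auto
  have sq: "(fst p + snd p)\<^sup>2 = L (quad_map p)" for p
    by (simp add: L_def quad_map_def split_def power2_eq_square algebra_simps)
  define b where "b t = (if snd t = 0 then (\<lambda>p. a (fst t, 1) p * L p) else a (fst t, 0))" for t :: "nat \<times> nat"
  have "b t \<in> deg_less ((Suc (Suc m) + 1 - fst t - snd t) div 2)" if "t \<in> parities" for t
  proof (cases "snd t = 0")
    case True
    have "a (fst t, 1) \<in> deg_less ((Suc m - fst t) div 2)"
      using a[of "(fst t, 1)"] that by (auto simp: parities_def)
    then have "b t \<in> deg_less ((Suc m - fst t) div 2 + 1)"
      using deg_less_mult[OF _ L] True by (simp add: b_def)
    \<comment> \<open>Starting from \<open>Suc m\<close> keeps the truncated subtraction exact,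
      since \<open>fst t\<close> is at most 1.\<close>
    moreover have "(Suc m - fst t) div 2 + 1 = (Suc (Suc m) + 1 - fst t - snd t) div 2"
      using that True by (auto simp: parities_def)
    ultimately show ?thesis by simp
  next
    case False
    then show ?thesis
      using a[of "(fst t, 0)"] that by (auto simp: parities_def b_def)
  qed
  moreover have "(\<lambda>p. (fst p + snd p) * f p) = (\<lambda>p. \<Sum>t\<in>parities. lift t (b t) p)"
    unfolding f sum_parities by (simp add: lift_def b_def sq[symmetric] fun_eq_iff power2_eq_square algebra_simps)
  ultimately show ?thesis unfolding lifts_def by blast
qed

text \<open>The same exchange in the first exponent, with \<open>(x - y)^2 = 1 - u + v\<close>
  moving into the coefficient.\<close>

lemma lifts_diff:
  assumes "f \<in> lifts (Suc m)"
  shows "(\<lambda>p. (fst p - snd p) * f p) \<in> lifts (Suc (Suc m))"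
proof -
  obtain a where a: "\<And>t. t \<in> parities \<Longrightarrow> a t \<in> deg_less ((Suc m + 1 - fst t - snd t) div 2)"
    and f: "f = (\<lambda>p. \<Sum>t\<in>parities. lift t (a t) p)"
    using assms by (auto simp: lifts_def)
  define L :: "real \<times> real \<Rightarrow> real" where "L p = 1 - fst p + snd p" for p
  have L: "L \<in> deg_less (Suc 1)"
    unfolding L_def[abs_def]
    by (intro deg_less_add deg_less_diff deg_less_const deg_less_fst deg_less_snd) auto
  have sq: "(fst p - snd p)\<^sup>2 = L (quad_map p)" for p
    by (simp add: L_def quad_map_def split_def power2_eq_square algebra_simps)
  define b where "b t = (if fst t = 0 then (\<lambda>p. a (1, snd t) p * L p) else a (0, snd t))" for t :: "nat \<times> nat"
  have "b t \<in> deg_less ((Suc (Suc m) + 1 - fst t - snd t) div 2)" if "t \<in> parities" for t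
  proof (cases "fst t = 0")
    case True
    have "a (1, snd t) \<in> deg_less ((Suc m - snd t) div 2)"
      using a[of "(1, snd t)"] that by (auto simp: parities_def)
    then have "b t \<in> deg_less ((Suc m - snd t) div 2 + 1)"
      using deg_less_mult[OF _ L] True by (simp add: b_def)
    moreover have "(Suc m - snd t) div 2 + 1 = (Suc (Suc m) + 1 - fst t - snd t) div 2"
      using that True by (auto simp: parities_def)
    ultimately show ?thesis by simp
  next
    case False
    then show ?thesis
      using a[of "(0, snd t)"] that by (auto simp: parities_def b_def)
  qed
  moreover have "(\<lambda>p. (fst p - snd p) * f p) = (\<lambda>p. \<Sum>t\<in>parities. lift t (b t) p)"
    unfolding f sum_parities by (simp add: lift_def b_def sq[symmetric] fun_eq_iff power2_eq_square algebra_simps)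
  ultimately show ?thesis unfolding lifts_def by blast
qed

lemma monomial_Suc: "monomial (Suc i) j p = fst p * monomial i j p"
  by (cases p) (simp add: monomial_def)

lemma monomial_0_Suc: "monomial 0 (Suc j) p = snd p * monomial 0 j p"
  by (cases p) (simp add: monomial_def)

text \<open>As \<open>x\<close> and \<open>y\<close> are half the sum and half the difference of
  \<open>x + y\<close> and \<open>x - y\<close>, closure under multiplication by these two suffices,
  starting from the constant 1.\<close>

lemma monomial_in_lifts: "monomial i j \<in> lifts (Suc (i + j))"
proof (induction i)
  case 0
  show ?case
  proof (induction j)
    case 0
    define a :: "nat \<times> nat \<Rightarrow> real \<times> real \<Rightarrow> real" where
      "a t = (if t = (0, 0) then (\<lambda>p. 1) else 0)" for t
    have "monomial 0 0 = (\<lambda>p. \<Sum>t\<in>parities. lift t (a t) p)"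
      unfolding sum_parities by (rule ext) (simp add: a_def lift_def monomial_def split_def)
    moreover have "a t \<in> deg_less ((Suc (0 + 0) + 1 - fst t - snd t) div 2)" for t
      using fun_space.subspace_0[OF subspace_deg_less] deg_less_const[of 1 1] by (cases "t = (0, 0)") (simp_all add: a_def)
    ultimately show ?case unfolding lifts_def by blast
  next
    case (Suc j)
    have *: "monomial 0 (Suc j) = (\<lambda>p. 1/2 * ((fst p + snd p) * monomial 0 j p)
        + (-1/2) * ((fst p - snd p) * monomial 0 j p))"
    proof (rule ext)
      have "y * k = 1/2 * ((x + y) * k) + (-1/2) * ((x - y) * k)" for x y k :: real by algebra
      then show "monomial 0 (Suc j) p = 1/2 * ((fst p + snd p) * monomial 0 j p)
        + (-1/2) * ((fst p - snd p) * monomial 0 j p)" for p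
        by (metis monomial_0_Suc)
    qed
    show ?case
      unfolding * add_Suc_right by (rule lifts_lincomb[OF lifts_sum[OF Suc.IH] lifts_diff[OF Suc.IH]])
  qed
next
  case (Suc i)
  have *: "monomial (Suc i) j = (\<lambda>p. 1/2 * ((fst p + snd p) * monomial i j p)
      + 1/2 * ((fst p - snd p) * monomial i j p))"
  proof (rule ext)
    have "x * k = 1/2 * ((x + y) * k) + 1/2 * ((x - y) * k)" for x y k :: real by algebra
    then show "monomial (Suc i) j p = 1/2 * ((fst p + snd p) * monomial i j p)
        + 1/2 * ((fst p - snd p) * monomial i j p)" for p
      by (metis monomial_Suc)
  qed
  show ?case
    unfolding * add_Suc by (rule lifts_lincomb[OF lifts_sum[OF Suc.IH] lifts_diff[OF Suc.IH]])
qed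

lemma deg_less_eq_lifts: "deg_less m = lifts m"
proof
  show "deg_less m \<subseteq> lifts m"
  proof
    fix f assume "f \<in> deg_less m"
    then show "f \<in> lifts m"
      unfolding deg_less_def
    proof (induction rule: fun_space.span_induct_alt)
      case base
      have "(\<lambda>p. 0) = (\<lambda>p. \<Sum>t\<in>parities. lift t (\<lambda>p. 0) p)" by (simp add: lift_def)
      moreover have "(\<lambda>p. 0) \<in> deg_less k" for k
        using fun_space.subspace_0[OF subspace_deg_less] by (simp add: zero_fun_def)
      ultimately show ?case unfolding lifts_def zero_fun_def
        by (intro CollectI exI[of _ "\<lambda>t p. 0"]) simp
    next
      case (step c x y)
      then obtain i j where "x = monomial i j" "i + j < m" by auto
      then have "x \<in> lifts m" using lifts_mono[OF monomial_in_lifts] by auto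
      then show ?case using lifts_lincomb[OF _ step.IH, of x c 1] by (simp add: plus_fun_def)
    qed
  qed
  show "lifts m \<subseteq> deg_less m"
  proof
    fix f assume "f \<in> lifts m"
    then obtain a where a: "\<And>t. t \<in> parities \<Longrightarrow> a t \<in> deg_less ((m + 1 - fst t - snd t) div 2)"
      and f: "f = (\<lambda>p. \<Sum>t\<in>parities. lift t (a t) p)"
      by (auto simp: lifts_def)
    have "lift t (a t) \<in> deg_less m" if "t \<in> parities" for t using lift_in_deg_less a that by blast
    then show "f \<in> deg_less m"
      unfolding f sum_parities by (intro deg_less_add) (auto simp: parities_def)
  qed
qed

section \<open>Integrals and inner products of lifts over \<open>G\<close>\<close>

definition lift_weight :: "(real \<times> real \<Rightarrow> real) \<Rightarrow> real \<times> real \<Rightarrow> real" where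
  "lift_weight W p = W (quad_map p) * \<bar>(fst p)\<^sup>2 - (snd p)\<^sup>2\<bar>"

lemma finite_moments_factor:
  assumes "finite_moments D W"
  shows "finite_moments D (\<lambda>p. factor t p * W p)"
  unfolding finite_moments_def
proof safe
  fix i j
  show "set_integrable lebesgue D (\<lambda>p. monomial i j p * (factor t p * W p))"
    using ip_integrable[OF assms monomial_in_all_polys factor_in_all_polys] by (simp add: mult.assoc)
qed

text \<open>The prefactor \<open>e\<close> of \<open>lift t f\<close> is not a function of \<open>quad_map p\<close>, but \<open>\<bar>e\<bar> \<le> 1 + e\<^sup>2\<close>, and
  \<open>e\<^sup>2\<close> is.\<close>

lemma integrable_lift:
  assumes W0: "\<And>p. p \<notin> Omega \<Longrightarrow> W p = 0" and mom: "finite_moments Omega W"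
    and f: "f \<in> all_polys"
  shows "set_integrable lebesgue G (\<lambda>p. lift t f p * lift_weight W p)"
proof -
  let ?e = "\<lambda>p::real\<times>real. (fst p - snd p) ^ fst t * (fst p + snd p) ^ snd t"
  let ?J = "\<lambda>p::real\<times>real. \<bar>(fst p)\<^sup>2 - (snd p)\<^sup>2\<bar>"
  have i1: "set_integrable lebesgue Omega (\<lambda>p. f p * W p)"
    using mom f by (rule finite_moments_integrable)
  have i2: "set_integrable lebesgue Omega (\<lambda>p. f p * (factor t p * W p))"
    using finite_moments_factor[OF mom] f by (rule finite_moments_integrable)
  have G1: "set_integrable lebesgue G (\<lambda>p. f (quad_map p) * W (quad_map p) * ?J p)"
    using integral_over_G(1)[OF i1] W0 by simp
  have G2: "set_integrable lebesgue G (\<lambda>p. f (quad_map p) * (factor t (quad_map p) * W (quad_map p)) * ?J p)"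
    using integral_over_G(1)[OF i2] W0 by simp
  have "integrable lebesgue (\<lambda>p. ?e p * (indicator G p *\<^sub>R (f (quad_map p) * W (quad_map p) * ?J p)))"
  proof (rule Bochner_Integration.integrable_bound)
    show "integrable lebesgue (\<lambda>p. \<bar>indicator G p *\<^sub>R (f (quad_map p) * W (quad_map p) * ?J p)\<bar> +
        \<bar>indicator G p *\<^sub>R (f (quad_map p) * (factor t (quad_map p) * W (quad_map p)) * ?J p)\<bar>)"
      using G1 G2 unfolding set_integrable_def
      by (intro Bochner_Integration.integrable_add integrable_abs)
    have "?e \<in> borel_measurable borel"
      by (intro borel_measurable_continuous_onI continuous_intros)
    then have "?e \<in> borel_measurable lebesgue"
      by (simp add: measurable_completion)
    then show "(\<lambda>p. ?e p * (indicator G p *\<^sub>R (f (quad_map p) * W (quad_map p) * ?J p)))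
        \<in> borel_measurable lebesgue"
      using borel_measurable_times[OF _ borel_measurable_integrable[OF G1[unfolded set_integrable_def]]]
      by blast
    show "AE p in lebesgue. norm (?e p * (indicator G p *\<^sub>R (f (quad_map p) * W (quad_map p) * ?J p)))
      \<le> norm (\<bar>indicator G p *\<^sub>R (f (quad_map p) * W (quad_map p) * ?J p)\<bar> +
        \<bar>indicator G p *\<^sub>R (f (quad_map p) * (factor t (quad_map p) * W (quad_map p)) * ?J p)\<bar>)"
    proof (rule AE_I2)
      fix p
      define e where "e = ?e p"
      define k where "k = indicator G p *\<^sub>R (f (quad_map p) * W (quad_map p) * ?J p)"
      have k2: "indicator G p *\<^sub>R (f (quad_map p) * (factor t (quad_map p) * W (quad_map p)) * ?J p)
          = e\<^sup>2 * k"
        by (simp add: factor_quad_map k_def e_def)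
      \<comment> \<open>Expanding \<open>(\<bar>e\<bar> - 1)^2 \<ge> 0\<close> gives even
        \<open>2 * \<bar>e\<bar> \<le> 1 + e^2\<close>.\<close>
      have "\<bar>e\<bar> \<le> 1 + e\<^sup>2"
        using zero_le_power2[of "\<bar>e\<bar> - 1"] abs_ge_zero[of e] unfolding power2_diff power2_abs by simp
      then have "\<bar>e\<bar> * \<bar>k\<bar> \<le> (1 + e\<^sup>2) * \<bar>k\<bar>" by (rule mult_right_mono) simp
      then show "norm (?e p * (indicator G p *\<^sub>R (f (quad_map p) * W (quad_map p) * ?J p)))
        \<le> norm (\<bar>indicator G p *\<^sub>R (f (quad_map p) * W (quad_map p) * ?J p)\<bar> +
        \<bar>indicator G p *\<^sub>R (f (quad_map p) * (factor t (quad_map p) * W (quad_map p)) * ?J p)\<bar>)"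
        unfolding k2 e_def[symmetric] k_def[symmetric] by (simp add: abs_mult distrib_right)
    qed
  qed
  moreover have "?e p * (indicator G p *\<^sub>R (f (quad_map p) * W (quad_map p) * ?J p)) =
      indicator G p *\<^sub>R (lift t f p * lift_weight W p)" for p
    by (simp add: lift_def lift_weight_def)
  ultimately show ?thesis unfolding set_integrable_def by (simp only:)
qed

text \<open>Each monomial is a sum of four lifts, and each lift is integrable against the
  weight.\<close>

lemma finite_moments_lift_weight:
  assumes W0: "\<And>p. p \<notin> Omega \<Longrightarrow> W p = 0" and mom: "finite_moments Omega W"
  shows "finite_moments G (lift_weight W)"
  unfolding finite_moments_def
proof safe
  fix i j
  have "monomial i j \<in> lifts (Suc (i + j))" by (rule monomial_in_lifts)
  then obtain a where a: "\<And>t. t \<in> parities \<Longrightarrow> a t \<in> deg_less ((Suc (i + j) + 1 - fst t - snd t) div 2)"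
    and f: "monomial i j = (\<lambda>p. \<Sum>t\<in>parities. lift t (a t) p)"
    by (auto simp: lifts_def)
  have "a t \<in> all_polys" if "t \<in> parities" for t using a[OF that] deg_less_subset_all_polys by blast
  then have "set_integrable lebesgue G (\<lambda>p. \<Sum>t\<in>parities. lift t (a t) p * lift_weight W p)"
    unfolding sum_parities by (intro set_integral_add integrable_lift W0 mom) (auto simp: parities_def)
  then show "set_integrable lebesgue G (\<lambda>p. monomial i j p * lift_weight W p)"
    unfolding f by (simp add: sum_distrib_right)
qed

text \<open>The two equal prefactors multiply to \<open>factor t (quad_map p)\<close>, so apart from
  the Jacobian factor the integrand is a function of \<open>quad_map p\<close>, and
  \<open>integral_over_G\<close> applies.\<close>

lemma ip_lift_same:
  assumes W0: "\<And>p. p \<notin> Omega \<Longrightarrow> W p = 0" and mom: "finite_moments Omega W"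
    and f: "f \<in> all_polys" and g: "g \<in> all_polys"
  shows "ip G (lift_weight W) (lift t f) (lift t g) = ip Omega (\<lambda>p. factor t p * W p) f g"
proof -
  have "set_integrable lebesgue Omega (\<lambda>p. f p * g p * (factor t p * W p))"
    by (intro ip_integrable finite_moments_factor mom f g)
  from integral_over_G(2)[OF this] W0 show ?thesis
    by (simp add: ip_def lift_def lift_weight_def factor_quad_map power2_eq_square ac_simps)
qed

text \<open>Some reflection changes the sign of exactly one of the two lifts and fixes the weight,
  so the integrand is odd under it.\<close>

lemma ip_lift_distinct:
  assumes "s \<in> parities" "t \<in> parities" "s \<noteq> t"
  shows "ip G (lift_weight W) (lift s f) (lift t g) = 0"
proof -
  \<comment> \<open>The choice is \<open>c = -1\<close> if only the second exponents differ, and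
    \<open>c = 1\<close> if the first ones do.\<close>
  obtain c :: real where c: "c = 1 \<or> c = -1"
    and m: "(-c) ^ fst s * c ^ snd s * ((-c) ^ fst t * c ^ snd t) = -1"
  proof (cases "fst s = fst t")
    case True
    then have "snd s \<noteq> snd t" using assms(3) by (simp add: prod_eq_iff)
    with assms True that[of "-1"] show ?thesis by (auto simp: parities_def)
  next
    case False
    with assms that[of 1] show ?thesis by (auto simp: parities_def)
  qed
  have l: "lift t f (reflect c p) = (-c) ^ fst t * c ^ snd t * lift t f p" for t f p
    unfolding lift_def reflect_simps(1,4,5)[OF c] power_mult_distrib by (simp add: ac_simps)
  have w: "lift_weight W (reflect c p) = lift_weight W p" for p
    unfolding lift_weight_def reflect_simps(1,2)[OF c] ..
  show ?thesis unfolding ip_def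
  proof (rule integral_G_odd[OF c])
    fix p
    have "lift s f (reflect c p) * lift t g (reflect c p) * lift_weight W (reflect c p) =
        ((-c) ^ fst s * c ^ snd s * ((-c) ^ fst t * c ^ snd t)) * (lift s f p * lift t g p * lift_weight W p)"
      unfolding l w by (simp only: ac_simps)
    then show "lift s f (reflect c p) * lift t g (reflect c p) * lift_weight W (reflect c p) =
        - (lift s f p * lift t g p * lift_weight W p)"
      unfolding m by simp
  qed
qed

text \<open>The coefficients \<open>f\<close> that may occur in the term \<open>lift t f\<close> of an orthogonal polynomial of
  degree \<open>m\<close> on \<open>G\<close>. The subtractions are truncated, so that a term of negative degree gets
  \<open>deg_less 0 = {0}\<close>.\<close>

definition lift_component ::
  "(real \<times> real \<Rightarrow> real) \<Rightarrow> nat \<Rightarrow> nat \<times> nat \<Rightarrow> (real \<times> real \<Rightarrow> real) set" where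
  "lift_component W m t = {f \<in> deg_less ((m + 2 - fst t - snd t) div 2).
     \<forall>q\<in>deg_less ((m + 1 - fst t - snd t) div 2). ip Omega (\<lambda>p. factor t p * W p) f q = 0}"

text \<open>For such \<open>m\<close> the two halved bounds are \<open>Suc d\<close> and
  \<open>d\<close>.\<close>

lemma lift_component_eq_orth_polys:
  assumes "m = 2 * d + fst t + snd t"
  shows "lift_component W m t = orth_polys Omega (\<lambda>p. factor t p * W p) d"
  by (simp add: lift_component_def orth_polys_eq assms)

text \<open>When the halved bounds agree, as for odd \<open>m - fst t - snd t\<close>, a coefficient
  is orthogonal to the whole space that contains it, and
  \<open>orthonormal_bases_nondegenerate\<close> makes it 0.\<close>

lemma lift_component_trivial:
  assumes mom: "finite_moments Omega (\<lambda>p. factor t p * W p)"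
    and on: "\<And>n. orthonormal_basis Omega (\<lambda>p. factor t p * W p) n {..n} (\<lambda>k. P k n)"
    and m: "(m + 2 - fst t - snd t) div 2 = (m + 1 - fst t - snd t) div 2"
  shows "lift_component W m t = {0}"
proof -
  have "f = 0" if "f \<in> lift_component W m t" for f
    using that[unfolded lift_component_def m]
    by (intro orthonormal_bases_nondegenerate[OF mom on, of f "(m + 1 - fst t - snd t) div 2"]) auto
  moreover have "0 \<in> lift_component W m t"
    using fun_space.subspace_0[OF subspace_deg_less] by (simp add: lift_component_def)
  ultimately show ?thesis by blast
qed

text \<open>This is linearity of \<open>lift t\<close> in its polynomial argument.\<close>

lemma span_lift: "fun_span (lift t ` A) = lift t ` fun_span A"
proof
  show "fun_span (lift t ` A) \<subseteq> lift t ` fun_span A"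
  proof (rule fun_space.span_minimal)
    show "lift t ` A \<subseteq> lift t ` fun_span A"
      using fun_space.span_superset[of A] by blast
    show "fun_space.subspace (lift t ` fun_span A)"
    proof (rule fun_space.subspaceI)
      have "0 = lift t 0" by (simp add: lift_def[abs_def] fun_eq_iff)
      then show "0 \<in> lift t ` fun_span A" using fun_space.span_zero by blast
    next
      fix x y assume "x \<in> lift t ` fun_span A" "y \<in> lift t ` fun_span A"
      then obtain a b where ab: "x = lift t a" "y = lift t b" "a \<in> fun_span A" "b \<in> fun_span A" by blast
      then have "x + y = lift t (a + b)" by (simp add: lift_def[abs_def] fun_eq_iff distrib_left)
      then show "x + y \<in> lift t ` fun_span A" using ab fun_space.span_add by blast
    next
      fix c x assume "x \<in> lift t ` fun_span A"
      then obtain a where a: "x = lift t a" "a \<in> fun_span A" by blast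
      then have "(\<lambda>p. c * x p) = lift t (\<lambda>p. c * a p)" by (simp add: lift_def[abs_def] fun_eq_iff)
      then show "(\<lambda>p. c * x p) \<in> lift t ` fun_span A" using a fun_space.span_scale by blast
    qed
  qed
  show "lift t ` fun_span A \<subseteq> fun_span (lift t ` A)"
  proof clarify
    fix f assume "f \<in> fun_span A"
    then show "lift t f \<in> fun_span (lift t ` A)"
    proof (induction rule: fun_space.span_induct_alt)
      case base
      have "lift t 0 = 0" by (simp add: lift_def[abs_def] fun_eq_iff)
      then show ?case by (metis fun_space.span_zero)
    next
      case (step c x y)
      have "lift t ((\<lambda>p. c * x p) + y) = (\<lambda>p. c * lift t x p) + lift t y"
        by (simp add: lift_def[abs_def] fun_eq_iff algebra_simps)
      moreover have "(\<lambda>p. c * lift t x p) + lift t y \<in> fun_span (lift t ` A)"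
        using fun_space.span_add[OF fun_space.span_scale[OF fun_space.span_base[OF imageI[OF step.hyps]]] step.IH] .
      ultimately show ?case by metis
    qed
  qed
qed

section \<open>Orthogonal polynomials on \<open>G\<close>, parity by parity\<close>

context
  fixes W :: "real \<times> real \<Rightarrow> real"
  assumes W0: "\<And>p. p \<notin> Omega \<Longrightarrow> W p = 0" and mom: "finite_moments Omega W"
begin

lemma ip_lift:
  assumes "s \<in> parities" "t \<in> parities" "f \<in> all_polys" "g \<in> all_polys"
  shows "ip G (lift_weight W) (lift s f) (lift t g) =
    (if s = t then ip Omega (\<lambda>p. factor t p * W p) f g else 0)"
  using ip_lift_same[OF W0 mom assms(3,4)] ip_lift_distinct[OF assms(1,2)] by simp

text \<open>Distinct parities are orthogonal, so a lift of parity \<open>t\<close> sees only the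
  coefficient \<open>f t\<close>.\<close>

lemma ip_sum_lift:
  assumes f: "\<And>s. s \<in> parities \<Longrightarrow> f s \<in> all_polys" and t: "t \<in> parities" and g: "g \<in> all_polys"
  shows "ip G (lift_weight W) (\<Sum>s\<in>parities. lift s (f s)) (lift t g) =
    ip Omega (\<lambda>p. factor t p * W p) (f t) g"
proof -
  have "ip G (lift_weight W) (\<Sum>s\<in>parities. lift s (f s)) (lift t g) =
      (\<Sum>s\<in>parities. ip G (lift_weight W) (lift s (f s)) (lift t g))"
    by (intro ip_sum_left finite_moments_lift_weight W0 mom lift_in_all_polys f g)
  also have "\<dots> = (\<Sum>s\<in>parities. if s = t then ip Omega (\<lambda>p. factor t p * W p) (f t) g else 0)"
    by (intro sum.cong) (auto simp: ip_lift f t g)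
  also have "\<dots> = ip Omega (\<lambda>p. factor t p * W p) (f t) g"
    using t by (simp add: parities_def)
  finally show ?thesis .
qed

text \<open>Testing against \<open>lift t q\<close> isolates the condition on \<open>f t\<close>.
  Sums of such lifts exhaust \<open>deg_less m\<close>, so the four conditions together amount to
  orthogonality.\<close>

lemma orth_polys_lift_weight:
  "orth_polys G (lift_weight W) m =
    {(\<Sum>t\<in>parities. lift t (f t)) |f. \<forall>t\<in>parities. f t \<in> lift_component W m t}"
proof -
  have sum_eq: "(\<lambda>p. \<Sum>t\<in>parities. lift t (f t) p) = (\<Sum>t\<in>parities. lift t (f t))" for f
    by (simp add: sum_parities plus_fun_def)
  have "(\<Sum>t\<in>parities. lift t (f t)) \<in> orth_polys G (lift_weight W) m \<longleftrightarrow> (\<forall>t\<in>parities. f t \<in> lift_component W m t)"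
    if f: "\<And>t. t \<in> parities \<Longrightarrow> f t \<in> deg_less ((m + 2 - fst t - snd t) div 2)" for f
  proof -
    let ?F = "\<Sum>t\<in>parities. lift t (f t)"
    have fa: "f t \<in> all_polys" if "t \<in> parities" for t using f[OF that] deg_less_subset_all_polys by blast
    \<comment> \<open>The bounds with \<open>m + 2\<close> are those of
      \<open>lifts (Suc m)\<close>, since degree at most \<open>m\<close> is degree below
      \<open>Suc m\<close>.\<close>
    have "?F \<in> lifts (Suc m)" unfolding lifts_def sum_eq[symmetric] using f by auto
    then have F: "?F \<in> deg_less (Suc m)" by (simp only: deg_less_eq_lifts)
    have "(\<forall>q\<in>deg_less m. ip G (lift_weight W) ?F q = 0) \<longleftrightarrow> (\<forall>t\<in>parities. f t \<in> lift_component W m t)"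
    proof safe
      fix i j assume orth: "\<forall>q\<in>deg_less m. ip G (lift_weight W) ?F q = 0" and t: "(i, j) \<in> parities"
      have "ip Omega (\<lambda>p. factor (i, j) p * W p) (f (i, j)) q = 0"
        if q: "q \<in> deg_less ((m + 1 - fst (i, j) - snd (i, j)) div 2)" for q
      proof -
        have "q \<in> all_polys" using q deg_less_subset_all_polys by blast
        then have "ip Omega (\<lambda>p. factor (i, j) p * W p) (f (i, j)) q = ip G (lift_weight W) ?F (lift (i, j) q)"
          using ip_sum_lift[of f, OF fa t] by metis
        also have "\<dots> = 0" using orth lift_in_deg_less[OF q] by blast
        finally show ?thesis .
      qed
      then show "f (i, j) \<in> lift_component W m (i, j)"
        using f[OF t] by (simp add: lift_component_def)
    next
      fix q assume c: "\<forall>t\<in>parities. f t \<in> lift_component W m t" and "q \<in> deg_less m"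
      then have "q \<in> lifts m" by (simp add: deg_less_eq_lifts)
      then obtain a where a: "\<And>t. t \<in> parities \<Longrightarrow> a t \<in> deg_less ((m + 1 - fst t - snd t) div 2)"
        and q: "q = (\<Sum>t\<in>parities. lift t (a t))"
        by (auto simp: lifts_def sum_eq)
      have aa: "a t \<in> all_polys" if "t \<in> parities" for t using a[OF that] deg_less_subset_all_polys by blast
      have Fa: "?F \<in> all_polys" using F deg_less_subset_all_polys by blast
      have "ip G (lift_weight W) ?F q = (\<Sum>t\<in>parities. ip G (lift_weight W) (lift t (a t)) ?F)"
        unfolding q ip_commute[of G _ ?F]
        by (intro ip_sum_left finite_moments_lift_weight W0 mom lift_in_all_polys aa Fa)
      also have "\<dots> = (\<Sum>t\<in>parities. 0)"
      proof (rule sum.cong)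
        fix t assume t: "t \<in> parities"
        show "ip G (lift_weight W) (lift t (a t)) ?F = 0"
          using ip_sum_lift[of f, OF fa t aa[OF t]] c t a[OF t]
          by (simp add: ip_commute[of G _ "lift t (a t)"] lift_component_def)
      qed simp
      finally show "ip G (lift_weight W) ?F q = 0" by simp
    qed
    then show ?thesis using F by (simp add: orth_polys_eq)
  qed
  note iff = this
  show ?thesis
  proof (intro equalityI subsetI)
    fix F assume F: "F \<in> orth_polys G (lift_weight W) m"
    then have "F \<in> lifts (Suc m)" by (simp add: orth_polys_eq deg_less_eq_lifts)
    then obtain f where f: "\<And>t. t \<in> parities \<Longrightarrow> f t \<in> deg_less ((m + 2 - fst t - snd t) div 2)"
      and "F = (\<Sum>t\<in>parities. lift t (f t))"
      by (auto simp: lifts_def sum_eq)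
    then show "F \<in> {(\<Sum>t\<in>parities. lift t (f t)) |f. \<forall>t\<in>parities. f t \<in> lift_component W m t}"
      using iff[of f] F by blast
  next
    fix F assume "F \<in> {(\<Sum>t\<in>parities. lift t (f t)) |f. \<forall>t\<in>parities. f t \<in> lift_component W m t}"
    then obtain f where f: "\<forall>t\<in>parities. f t \<in> lift_component W m t" and F: "F = (\<Sum>t\<in>parities. lift t (f t))"
      by blast
    have "\<And>t. t \<in> parities \<Longrightarrow> f t \<in> deg_less ((m + 2 - fst t - snd t) div 2)"
      using f by (simp add: lift_component_def)
    then show "F \<in> orth_polys G (lift_weight W) m" using iff[of f] f F by blast
  qed
qed

text \<open>In each degree only two parities carry nonzero coefficients: \<open>(0, 0)\<close> and
  \<open>(1, 1)\<close> in even degree, \<open>(0, 1)\<close> and \<open>(1, 0)\<close> in odd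
  degree. The lifts of their orthonormal families are jointly orthonormal, and their spans add up to
  the whole space.\<close>

lemma lift_bases:
  assumes st: "s \<in> parities" "t \<in> parities" "s \<noteq> t"
    and fin: "finite I" "finite J"
    and onP: "\<And>i j. i \<in> I \<Longrightarrow> j \<in> I \<Longrightarrow>
      ip Omega (\<lambda>p. factor s p * W p) (P i) (P j) = (if i = j then 1 else 0)"
    and onR: "\<And>i j. i \<in> J \<Longrightarrow> j \<in> J \<Longrightarrow>
      ip Omega (\<lambda>p. factor t p * W p) (R i) (R j) = (if i = j then 1 else 0)"
    and spP: "fun_span (P ` I) = lift_component W m s"
    and spR: "fun_span (R ` J) = lift_component W m t"
    and triv: "\<And>r. r \<in> parities \<Longrightarrow> r \<noteq> s \<Longrightarrow> r \<noteq> t \<Longrightarrow> lift_component W m r = {0}"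
  shows "mutually_orthogonal_basis G (lift_weight W) m (I <+> J)
    (case_sum (\<lambda>k. lift s (P k)) (\<lambda>k. lift t (R k)))" (is "mutually_orthogonal_basis _ _ _ _ ?f")
proof (rule orthonormal_family_basis)
  have ca: "lift_component W m r \<subseteq> all_polys" for r
    unfolding lift_component_def using deg_less_subset_all_polys by blast
  have Pa: "P i \<in> all_polys" if "i \<in> I" for i
    using that fun_space.span_superset[of "P ` I"] spP ca by blast
  have Ra: "R i \<in> all_polys" if "i \<in> J" for i
    using that fun_space.span_superset[of "R ` J"] spR ca by blast
  show "finite (I <+> J)" using fin by simp
  show "finite_moments G (lift_weight W)" by (intro finite_moments_lift_weight W0 mom)
  show "?f i \<in> all_polys" if "i \<in> I <+> J" for i
    using that by (auto intro!: lift_in_all_polys Pa Ra)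
  show "ip G (lift_weight W) (?f i) (?f j) = (if i = j then 1 else 0)"
    if "i \<in> I <+> J" "j \<in> I <+> J" for i j
    using that st Pa Ra onP onR by (auto simp: ip_lift split: if_splits)
  have lift0: "lift r 0 = 0" for r by (simp add: lift_def[abs_def] fun_eq_iff)
  have "?f ` (I <+> J) = lift s ` P ` I \<union> lift t ` R ` J"
    by (simp add: Plus_def image_Un image_image)
  then have "fun_span (?f ` (I <+> J)) =
      {x + y |x y. x \<in> lift s ` lift_component W m s \<and> y \<in> lift t ` lift_component W m t}"
    by (simp only: fun_space.span_Un span_lift spP spR)
  also have "\<dots> = {(\<Sum>r\<in>parities. lift r (f r)) |f. \<forall>r\<in>parities. f r \<in> lift_component W m r}"
  proof -
    have *: "(\<Sum>r\<in>parities. lift r (f r)) = lift s (f s) + lift t (f t)"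
      if "\<And>r. r \<in> parities \<Longrightarrow> r \<noteq> s \<Longrightarrow> r \<noteq> t \<Longrightarrow> f r = 0" for f
    proof -
      have "(\<Sum>r\<in>parities. lift r (f r)) = (\<Sum>r\<in>{s, t}. lift r (f r))"
        using st that by (intro sum.mono_neutral_right) (auto simp: parities_def lift0)
      then show ?thesis using st(3) by (simp add: plus_fun_def)
    qed
    show ?thesis
    proof (intro equalityI subsetI)
      fix z assume "z \<in> {x + y |x y. x \<in> lift s ` lift_component W m s \<and> y \<in> lift t ` lift_component W m t}"
      then obtain a b where z: "z = lift s a + lift t b"
        and ab: "a \<in> lift_component W m s" "b \<in> lift_component W m t" by blast
      define f where "f r = (if r = s then a else if r = t then b else 0)" for r
      have "z = (\<Sum>r\<in>parities. lift r (f r))" using *[of f] st(3) by (simp add: f_def z)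
      moreover have "\<forall>r\<in>parities. f r \<in> lift_component W m r" using ab triv by (auto simp: f_def)
      ultimately show "z \<in> {(\<Sum>r\<in>parities. lift r (f r)) |f. \<forall>r\<in>parities. f r \<in> lift_component W m r}" by blast
    next
      fix z assume "z \<in> {(\<Sum>r\<in>parities. lift r (f r)) |f. \<forall>r\<in>parities. f r \<in> lift_component W m r}"
      then obtain f where f: "\<forall>r\<in>parities. f r \<in> lift_component W m r" and z: "z = (\<Sum>r\<in>parities. lift r (f r))" by blast
      have "z = lift s (f s) + lift t (f t)" unfolding z by (rule *) (use f triv in blast)
      then show "z \<in> {x + y |x y. x \<in> lift s ` lift_component W m s \<and> y \<in> lift t ` lift_component W m t}"
        using f st by blast
    qed
  qed
  finally show "fun_span (?f ` (I <+> J)) = orth_polys G (lift_weight W) m"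
    by (simp only: orth_polys_lift_weight)
qed

end

section \<open>The weights and bases of the theorem\<close>

lemma W_weight_ij_eq: "W_weight_ij w \<gamma> i j = (\<lambda>p. factor (i, j) p * W_weight w \<gamma> p)"
  by (simp add: fun_eq_iff W_weight_ij_def factor_def)

lemma G_weight_eq: "G_weight w \<gamma> = lift_weight (W_weight w \<gamma>)"
  by (simp add: fun_eq_iff G_weight_def lift_weight_def quad_map_def)

lemma lift_00_eq: "lift (0, 0) f = (\<lambda>(x, y). f (2 * x * y, x\<^sup>2 + y\<^sup>2 - 1))"
  by (rule ext) (simp add: lift_def quad_map_def split_def)

lemma lift_01_eq: "lift (0, 1) f = (\<lambda>(x, y). (x + y) * f (2 * x * y, x\<^sup>2 + y\<^sup>2 - 1))"
  by (rule ext) (simp add: lift_def quad_map_def split_def)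

lemma lift_10_eq: "lift (1, 0) f = (\<lambda>(x, y). (x - y) * f (2 * x * y, x\<^sup>2 + y\<^sup>2 - 1))"
  by (rule ext) (simp add: lift_def quad_map_def split_def)

lemma lift_11_eq: "lift (1, 1) f = (\<lambda>(x, y). (x\<^sup>2 - y\<^sup>2) * f (2 * x * y, x\<^sup>2 + y\<^sup>2 - 1))"
proof (rule ext)
  have "x\<^sup>2 - y\<^sup>2 = (x - y) * (x + y)" for x y :: real
    by (simp add: power2_eq_square algebra_simps)
  then show "lift (1, 1) f p = (\<lambda>(x, y). (x\<^sup>2 - y\<^sup>2) * f (2 * x * y, x\<^sup>2 + y\<^sup>2 - 1)) p" for p
    by (simp add: lift_def quad_map_def split_def)
qed

theorem theorem3p4:
  fixes w :: "real \<Rightarrow> real" and \<gamma> :: real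
    and P P11 P10 P01 :: "nat \<Rightarrow> nat \<Rightarrow> real \<times> real \<Rightarrow> real"
  assumes w_meas: "set_borel_measurable lebesgue {1..} w"
    and w_nonneg: "\<And>x. x \<ge> 1 \<Longrightarrow> w x \<ge> 0"
    and w_pos: "(\<integral>\<^sup>+x\<in>{1..}. ennreal (w x) \<partial>lebesgue) > 0"
    and gamma: "\<gamma> > -1"
    and moments: "finite_moments Omega (W_weight w \<gamma>)"
    and P: "\<And>n. orthonormal_basis Omega (W_weight w \<gamma>) n {..n} (\<lambda>k. P k n)"
    and P11: "\<And>n. orthonormal_basis Omega (W_weight_ij w \<gamma> 1 1) n {..n} (\<lambda>k. P11 k n)"
    and P10: "\<And>n. orthonormal_basis Omega (W_weight_ij w \<gamma> 1 0) n {..n} (\<lambda>k. P10 k n)"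
    and P01: "\<And>n. orthonormal_basis Omega (W_weight_ij w \<gamma> 0 1) n {..n} (\<lambda>k. P01 k n)"
  shows "finite_moments G (G_weight w \<gamma>) \<and>
    (\<forall>n.
      mutually_orthogonal_basis G (G_weight w \<gamma>) (2 * n) ({..n} <+> {..<n})
        (case_sum
          (\<lambda>k (x, y). P k n (2 * x * y, x\<^sup>2 + y\<^sup>2 - 1))
          (\<lambda>k (x, y). (x\<^sup>2 - y\<^sup>2) * P11 k (n - 1) (2 * x * y, x\<^sup>2 + y\<^sup>2 - 1))) \<and>
      mutually_orthogonal_basis G (G_weight w \<gamma>) (2 * n + 1) ({..n} <+> {..n})
        (case_sum
          (\<lambda>k (x, y). (x + y) * P01 k n (2 * x * y, x\<^sup>2 + y\<^sup>2 - 1))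
          (\<lambda>k (x, y). (x - y) * P10 k n (2 * x * y, x\<^sup>2 + y\<^sup>2 - 1))))"
proof (intro conjI allI)
  define W where "W = W_weight w \<gamma>"
  have W0: "W p = 0" if "p \<notin> Omega" for p
    using that by (cases p) (simp add: W_def W_weight_def)
  have mom: "finite_moments Omega W" using moments by (simp add: W_def)
  have GW: "G_weight w \<gamma> = lift_weight W" by (simp add: W_def G_weight_eq)
  note momf = finite_moments_factor[OF mom]
  have B00: "orthonormal_basis Omega (\<lambda>p. factor (0, 0) p * W p) n {..n} (\<lambda>k. P k n)" for n
  proof -
    have "factor (0, 0) p * W p = W_weight w \<gamma> p" for p by (simp add: W_def factor_def)
    then show ?thesis using P[of n] by (simp only:)
  qed
  have B11: "orthonormal_basis Omega (\<lambda>p. factor (1, 1) p * W p) n {..n} (\<lambda>k. P11 k n)" for n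
    using P11[of n] unfolding W_weight_ij_eq W_def .
  have B10: "orthonormal_basis Omega (\<lambda>p. factor (1, 0) p * W p) n {..n} (\<lambda>k. P10 k n)" for n
    using P10[of n] unfolding W_weight_ij_eq W_def .
  have B01: "orthonormal_basis Omega (\<lambda>p. factor (0, 1) p * W p) n {..n} (\<lambda>k. P01 k n)" for n
    using P01[of n] unfolding W_weight_ij_eq W_def .
  show "finite_moments G (G_weight w \<gamma>)"
    unfolding GW using W0 mom by (rule finite_moments_lift_weight)
  fix n
  \<comment> \<open>For the parities \<open>(1, 0)\<close> and \<open>(0, 1)\<close> both halved
    bounds equal \<open>n\<close>.\<close>
  have triv_even: "lift_component W (2 * n) r = {0}"
    if "r \<in> parities" "r \<noteq> (0, 0)" "r \<noteq> (1, 1)" for r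
  proof -
    have "r = (1, 0) \<or> r = (0, 1)" using that by (auto simp: parities_def)
    moreover have "lift_component W (2 * n) (1, 0) = {0}"
      by (rule lift_component_trivial[OF momf B10]) simp
    moreover have "lift_component W (2 * n) (0, 1) = {0}"
      by (rule lift_component_trivial[OF momf B01]) simp
    ultimately show ?thesis by blast
  qed
  \<comment> \<open>Both halved bounds equal \<open>Suc n\<close> for \<open>(0, 0)\<close> and
    \<open>n\<close> for \<open>(1, 1)\<close>.\<close>
  have triv_odd: "lift_component W (2 * n + 1) r = {0}"
    if "r \<in> parities" "r \<noteq> (0, 1)" "r \<noteq> (1, 0)" for r
  proof -
    have "r = (0, 0) \<or> r = (1, 1)" using that by (auto simp: parities_def)
    moreover have "lift_component W (2 * n + 1) (0, 0) = {0}"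
      by (rule lift_component_trivial[OF momf B00]) simp
    moreover have "lift_component W (2 * n + 1) (1, 1) = {0}"
      by (rule lift_component_trivial[OF momf B11]) simp
    ultimately show ?thesis by blast
  qed
  have c00: "fun_span ((\<lambda>k. P k n) ` {..n}) = lift_component W (2 * n) (0, 0)"
    using orthonormal_basis_span[OF B00[of n]] by (subst lift_component_eq_orth_polys[of _ n]) simp_all
  have c01: "fun_span ((\<lambda>k. P01 k n) ` {..n}) = lift_component W (2 * n + 1) (0, 1)"
    using orthonormal_basis_span[OF B01[of n]] by (subst lift_component_eq_orth_polys[of _ n]) simp_all
  have c10: "fun_span ((\<lambda>k. P10 k n) ` {..n}) = lift_component W (2 * n + 1) (1, 0)"
    using orthonormal_basis_span[OF B10[of n]] by (subst lift_component_eq_orth_polys[of _ n]) simp_all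
  \<comment> \<open>The prefactor \<open>x^2 - y^2\<close> takes up two degrees, which leaves
    coefficients of degree \<open>n - 1\<close>. For \<open>n = 0\<close> the index set is empty and
    the component is \<open>{0}\<close>, so the truncated value of \<open>n - 1\<close> does not
    matter.\<close>
  have c11: "fun_span ((\<lambda>k. P11 k (n - 1)) ` {..<n}) = lift_component W (2 * n) (1, 1)"
  proof (cases n)
    case 0
    have "lift_component W (2 * n) (1, 1) \<subseteq> deg_less 0"
      by (auto simp: lift_component_def 0)
    moreover have "0 \<in> lift_component W (2 * n) (1, 1)"
      using fun_space.subspace_0[OF subspace_deg_less] by (simp add: lift_component_def)
    ultimately have "lift_component W (2 * n) (1, 1) = {0}" unfolding deg_less_0 by blast
    then show ?thesis using 0 by simp
  next
    case (Suc d)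
    then show ?thesis
      using orthonormal_basis_span[OF B11[of d]]
      by (subst lift_component_eq_orth_polys[of _ d]) (simp_all add: lessThan_Suc_atMost)
  qed
  have ip11: "ip Omega (\<lambda>p. factor (1, 1) p * W p) (P11 i (n - 1)) (P11 j (n - 1)) = (if i = j then 1 else 0)"
    if "i \<in> {..<n}" "j \<in> {..<n}" for i j
    using that by (intro orthonormal_basis_ip[OF B11]) auto
  have even: "mutually_orthogonal_basis G (lift_weight W) (2 * n) ({..n} <+> {..<n})
      (case_sum (\<lambda>k. lift (0, 0) (P k n)) (\<lambda>k. lift (1, 1) (P11 k (n - 1))))"
    by (rule lift_bases[OF W0 mom _ _ _ _ _ orthonormal_basis_ip[OF B00] ip11 c00 c11 triv_even])
      (simp_all add: parities_def)
  have odd: "mutually_orthogonal_basis G (lift_weight W) (2 * n + 1) ({..n} <+> {..n})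
      (case_sum (\<lambda>k. lift (0, 1) (P01 k n)) (\<lambda>k. lift (1, 0) (P10 k n)))"
    by (rule lift_bases[OF W0 mom _ _ _ _ _ orthonormal_basis_ip[OF B01] orthonormal_basis_ip[OF B10]
        c01 c10 triv_odd]) (simp_all add: parities_def)
  show "mutually_orthogonal_basis G (G_weight w \<gamma>) (2 * n) ({..n} <+> {..<n})
        (case_sum
          (\<lambda>k (x, y). P k n (2 * x * y, x\<^sup>2 + y\<^sup>2 - 1))
          (\<lambda>k (x, y). (x\<^sup>2 - y\<^sup>2) * P11 k (n - 1) (2 * x * y, x\<^sup>2 + y\<^sup>2 - 1)))"
    using even unfolding lift_00_eq lift_11_eq GW .
  show "mutually_orthogonal_basis G (G_weight w \<gamma>) (2 * n + 1) ({..n} <+> {..n})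
        (case_sum
          (\<lambda>k (x, y). (x + y) * P01 k n (2 * x * y, x\<^sup>2 + y\<^sup>2 - 1))
          (\<lambda>k (x, y). (x - y) * P10 k n (2 * x * y, x\<^sup>2 + y\<^sup>2 - 1)))"
    using odd unfolding lift_01_eq lift_10_eq GW .
qed

end
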